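(* Let $(X,d)$ be a compact metric space, let $0<s<1$, and let $\phi_i:X\to X$, $i\in\mathbb{N}$, satisfy $d(\phi_i(x),\phi_i(y))\le s\,d(x,y)$ for all $i\in\mathbb{N}$ and $x,y\in X$. Let $\phi^{(i)}:X\to\mathbb{R}$, $i\in\mathbb{N}$, be continuous functions with $\sup_{x\in X}\sum_{i\in\mathbb{N}}e^{\phi^{(i)}(x)}<\infty$, and define $\phi:\Sigma\to\mathbb{R}$ by $\phi(\omega)=\phi^{(\omega_1)}(\pi(\sigma(\omega)))$. Suppose that $\phi$ is Hölder continuous. Put $\lambda=e^{P(\phi)}$. Then: (1) $\phi$ is positive recurrent with this $\lambda$, and there exists $M>0$ such that $M^{-1}\le\lambda^{-n}\mathcal{L}_\phi^n(\mathbf 1)\le M$ (pointwise on $\Sigma$) for all $n\ge1$. (2) Suppose additionally that $\phi_i(X)\cap\phi_j(X)=\emptyset$ for all $i,j\in\mathbb{N}$, $i\ne j$. Then there are a Borel probability measure $\nu$ on $\Sigma$ and a Hölder continuous function $h:\Sigma\to(0,\infty)$, bounded away from zero and infinity, such that $\mathcal{L}_\phi^*(\nu)=\lambda\nu$, $\mathcal{L}_\phi(h)=\lambda h$, $\int h\,d\nu=1$, and $\lambda^{-n}\mathcal{L}_\phi^n(g)\to\left(\int g\,d\nu\right)h$ uniformly on $\Sigma$ for every uniformly continuous bounded function $g:\Sigma\to\mathbb{R}$. Additionally, $\lambda^{-n}\mathcal{L}_\phi^n(g)\to\left(\int g\,d\nu\right)h$ exponentially fast (in the supremum norm) for each Hölder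 continuous bounded function $g:\Sigma\to\mathbb{R}$.
   Context: $\mathbb{N}$ is the set of positive integers, $\Sigma=\mathbb{N}^{\infty}$ is the space of infinite sequences $\omega=\omega_1\omega_2\ldots$ with the product topology ($\mathbb{N}$ discrete), and $\sigma:\Sigma\to\Sigma$ is the shift $\sigma(\{x_n\}_{n\ge1})=\{x_{n+1}\}_{n\ge1}$. For $\omega\in\mathbb{N}^n$, $|\omega|=n$ and $[\omega]=\{\rho\in\Sigma:\rho_1=\omega_1,\ldots,\rho_n=\omega_n\}$. Fix $\beta>0$. For $f:\Sigma\to\mathbb{R}$ and $n\ge1$, $V_n(f)=\sup\{|f(x)-f(y)|:x_1=y_1,\ldots,x_n=y_n\}$. The function $f$ is Hölder continuous (of order $\beta$) if $V(f)=\sup_{n\ge1}e^{\beta n}V_n(f)<\infty$. Uniform continuity of $f$ on $\Sigma$ is with respect to the product uniformity, i.e. $V_n(f)\to0$ as $n\to\infty$. Projection: for $\omega\in\Sigma$, $\phi_{\omega|_n}=\phi_{\omega_1}\circ\cdots\circ\phi_{\omega_n}$, and $\pi(\omega)$ is the unique point of $\bigcap_{n\ge1}\phi_{\omega|_n}(X)$. Transfer operator: on the space $C_b(\Sigma)$ of bounded continuous real functions, $\mathcal{L}_\phi(g)(\omega)=\sum_{\tau\in\sigma^{-1}(\omega)}e^{\phi(\tau)}g(\tau)$. $\mathcal{L}_\phi^*$ is the conjugate operator; $\mathcal{L}_\phi^*(\nu)=\lambda\nu$ means $\int\mathcal{L}_\phi(g)\,d\nu=\lambda\int g\,d\nu$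 for all $g\in C_b(\Sigma)$. $\mathbf 1$ is the constant function 1. Topological pressure: $P(\phi)=\lim_{n\to\infty}\frac1n\log\left(\sum_{|\omega|=n}\sup_{\tau\in[\omega]}\exp\left(\sum_{j=0}^{n-1}\phi(\sigma^j(\tau))\right)\right)$. Positive recurrence: for $i\in\mathbb{N}$ let $Z_n(\phi,i)=\sum\exp\left(\sum_{j=0}^{n-1}\phi(\sigma^j(\omega))\right)$, the sum being over all $\omega\in\Sigma$ with $\sigma^n(\omega)=\omega$ and $\omega_1=i$. The function $\phi$ is positive recurrent (with $\lambda>0$) if for every $i\in\mathbb{N}$ there exist a constant $M_i$ and an integer $N_i$ such that $M_i^{-1}\le Z_n(\phi,i)\lambda^{-n}\le M_i$ for all $n\ge N_i$. Exponentially fast convergence in the supremum norm means that $\sup_\Sigma|\lambda^{-n}\mathcal{L}_\phi^n(g)-(\int g\,d\nu)h|\le C\theta^n$ for all $n\ge 1$, with some $C<\infty$ and $\theta\in(0,1)$. *)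

theory Defs
  imports "HOL-Probability.Probability"
begin

text \<open>
  The alphabet \<open>{1, 2, \<dots>}\<close> is relabelled as \<^typ>\<open>nat\<close> and coordinates are counted from \<open>0\<close>, so
  \<open>\<omega> k\<close> is the letter written \<open>\<omega>\<^sub>k\<^sub>+\<^sub>1\<close> in one-based notation. The topology and the Borel
  sets of \<^typ>\<open>nat \<Rightarrow> nat\<close> are those of the library's product topology, with \<^typ>\<open>nat\<close> discrete.
\<close>

type_synonym seq = "nat \<Rightarrow> nat"

definition shift_map :: "seq \<Rightarrow> seq" where
  "shift_map \<omega> = (\<lambda>n. \<omega> (Suc n))"

definition cylinder :: "nat list \<Rightarrow> seq set" where
  "cylinder w = {\<tau>. \<forall>k<length w. \<tau> k = w ! k}"

definition birkhoff_sum :: "(seq \<Rightarrow> real) \<Rightarrow> nat \<Rightarrow> seq \<Rightarrow> real" where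
  "birkhoff_sum \<phi> n \<omega> = (\<Sum>j<n. \<phi> ((shift_map ^^ j) \<omega>))"

definition variation :: "nat \<Rightarrow> (seq \<Rightarrow> real) \<Rightarrow> ennreal" where
  "variation n f = (SUP (x, y) \<in> {(x, y). \<forall>k<n. x k = y k}. ennreal \<bar>f x - f y\<bar>)"

definition holder_const :: "real \<Rightarrow> (seq \<Rightarrow> real) \<Rightarrow> ennreal" where
  "holder_const \<beta> f = (SUP n \<in> {1..}. ennreal (exp (\<beta> * real n)) * variation n f)"

definition holder_continuous :: "real \<Rightarrow> (seq \<Rightarrow> real) \<Rightarrow> bool" where
  "holder_continuous \<beta> f \<longleftrightarrow> holder_const \<beta> f < \<infinity>"

text \<open>Uniform continuity for the product uniformity: the sets of pairs agreeing in the first \<open>n\<close>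
  coordinates are a base of it.\<close>

definition unif_continuous :: "(seq \<Rightarrow> real) \<Rightarrow> bool" where
  "unif_continuous f \<longleftrightarrow> (\<lambda>n. variation n f) \<longlonglongrightarrow> 0"

primrec ifs_comp :: "(nat \<Rightarrow> 'a \<Rightarrow> 'a) \<Rightarrow> seq \<Rightarrow> nat \<Rightarrow> 'a \<Rightarrow> 'a" where
  "ifs_comp T \<omega> 0 = id"
| "ifs_comp T \<omega> (Suc n) = ifs_comp T \<omega> n \<circ> T (\<omega> n)"

definition ifs_proj :: "'a set \<Rightarrow> (nat \<Rightarrow> 'a \<Rightarrow> 'a) \<Rightarrow> seq \<Rightarrow> 'a" where
  "ifs_proj X T \<omega> = (THE x. x \<in> (\<Inter>n\<in>{1..}. ifs_comp T \<omega> n ` X))"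

definition transfer_op :: "(seq \<Rightarrow> real) \<Rightarrow> (seq \<Rightarrow> real) \<Rightarrow> seq \<Rightarrow> real" where
  "transfer_op \<phi> g \<omega> = (\<Sum>\<^sub>\<infinity>\<tau>\<in>shift_map -` {\<omega>}. exp (\<phi> \<tau>) * g \<tau>)"

text \<open>The eigenmeasure equation for the conjugate operator, tested against bounded continuous
  functions.\<close>

definition conj_transfer_eigen :: "(seq \<Rightarrow> real) \<Rightarrow> real \<Rightarrow> seq measure \<Rightarrow> bool" where
  "conj_transfer_eigen \<phi> lam \<nu> \<longleftrightarrow>
     (\<forall>g. continuous_on UNIV g \<and> bounded (range g) \<longrightarrow>
        (\<integral>\<omega>. transfer_op \<phi> g \<omega> \<partial>\<nu>) = lam * (\<integral>\<omega>. g \<omega> \<partial>\<nu>))"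

text \<open>\<^const>\<open>infsum\<close>, real suprema and \<^const>\<open>lim\<close> are total. If \<open>\<phi>\<close> is Hoelder continuous and
  the series \<open>\<Sum> exp (\<phi> \<tau>)\<close> over \<open>shift_map \<tau> = \<omega>\<close> converge with bounded sums, then for \<open>n \<ge> 1\<close> all
  series and suprema below are finite and the limit exists, so no default values enter.\<close>

definition partition_sum :: "(seq \<Rightarrow> real) \<Rightarrow> nat \<Rightarrow> real" where
  "partition_sum \<phi> n =
     (\<Sum>\<^sub>\<infinity>w\<in>{w. length w = n}. SUP \<tau>\<in>cylinder w. exp (birkhoff_sum \<phi> n \<tau>))"

definition pressure :: "(seq \<Rightarrow> real) \<Rightarrow> real" where
  "pressure \<phi> = lim (\<lambda>n. 1 / real n * ln (partition_sum \<phi> n))"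

definition periodic_sum :: "(seq \<Rightarrow> real) \<Rightarrow> nat \<Rightarrow> nat \<Rightarrow> real" where
  "periodic_sum \<phi> n i =
     (\<Sum>\<^sub>\<infinity>\<omega>\<in>{\<omega>. (shift_map ^^ n) \<omega> = \<omega> \<and> \<omega> 0 = i}. exp (birkhoff_sum \<phi> n \<omega>))"

definition positive_recurrent :: "(seq \<Rightarrow> real) \<Rightarrow> real \<Rightarrow> bool" where
  "positive_recurrent \<phi> lam \<longleftrightarrow>
     lam > 0 \<and>
     (\<forall>i. \<exists>M>0. \<exists>N. \<forall>n\<ge>N. inverse M \<le> periodic_sum \<phi> n i / lam ^ n \<and>
                              periodic_sum \<phi> n i / lam ^ n \<le> M)"

end

theory Submission
  imports Defs
begin

text \<open>
  Write \<open>L\<close> for the transfer operator and \<open>r = exp (- \<beta>)\<close>. The iterated function system enters through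
  the fact that \<open>\<pi>\<close> takes values in \<open>X\<close>: the bound on \<open>\<Sum> exp (\<psi> i x)\<close> then says that \<open>\<Sum> exp (\<phi> (i \<omega>))\<close>
  converges for every \<open>\<omega>\<close>. What remains is Ruelle's theorem for a Hoelder potential on the full shift
  with countably many letters. The shift space is not compact; the eigenfunction and the eigenmeasure
  are both obtained from a contraction argument.

  Prepending a letter contracts distances by \<open>r\<close>, so \<open>L\<close> maps the cone of positive functions with
  \<open>f x \<le> exp (a r ^ m) f y\<close>, whenever \<open>x\<close> and \<open>y\<close> agree in \<open>m\<close> coordinates, into such a cone with a smaller
  constant. The gap allows one to subtract from \<open>L f\<close> a multiple of \<open>L g\<close> worth a fixed proportion of
  \<open>L f\<close> and to remain in the cone (\<open>cone_split\<close>). Iterating, \<open>L ^^ n f\<close> is a multiple of \<open>L ^^ n g\<close> up to a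
  relative error \<open>\<theta> ^ n\<close> (\<open>Lpow_split\<close>), and the ratios converge exponentially fast to a constant
  (\<open>ratio_limit\<close>). Applied to \<open>f = L 1\<close> and \<open>g = 1\<close> this yields the eigenvalue \<open>\<rho>\<close>, the eigenfunction
  \<open>h = lim L ^^ n 1 / \<rho> ^ n\<close>, and two-sided bounds on \<open>L ^^ n 1 / \<rho> ^ n\<close> (\<open>h_limit\<close>). Expanding \<open>L ^^ n\<close> over
  words, bounded distortion compares \<open>L ^^ n 1\<close> with the partition sums and with the sums over periodic
  points; hence \<open>\<rho>\<close> is the exponential of the pressure (\<open>pressure_eq\<close>) and \<open>\<phi>\<close> is positive recurrent.

  Every Hoelder function becomes an element of the cone after adding a constant. Thus
  \<open>L ^^ n g / \<rho> ^ n\<close> converges exponentially fast to \<open>ell g * h\<close> with a positive linear functional \<open>ell\<close>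
  (\<open>ell_rate\<close>). On indicators of sets that depend on finitely many coordinates, \<open>ell\<close> is countably
  additive, since the weights of words have a summable majorant (\<open>ell_tendsto_0\<close>). Kolmogorov's
  extension theorem turns it into a probability measure \<open>\<nu>\<close> (\<open>exists_measure\<close>), and approximation by
  functions of finitely many coordinates identifies \<open>ell\<close> with the integral, extends the convergence to
  uniformly continuous functions, and gives the eigenmeasure equation for bounded continuous ones.
\<close>

section \<open>Sequences and words\<close>

text \<open>
  The ultrametric of the full shift in relational form: with \<open>r = exp (- \<beta>)\<close>, the pairs agreeing in
  \<open>m\<close> coordinates are those at distance at most \<open>r ^ m\<close>, so Hoelder continuity of order \<open>\<beta>\<close> is
  Lipschitz continuity for that metric.
\<close>

definition agree :: "nat \<Rightarrow> seq \<Rightarrow> seq \<Rightarrow> bool" where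
  "agree m x y \<longleftrightarrow> (\<forall>k<m. x k = y k)"

lemma agree_0 [simp]: "agree 0 x y"
  by (simp add: agree_def)

lemma agree_refl: "agree m x x"
  by (simp add: agree_def)

lemma agree_sym: "agree m x y \<Longrightarrow> agree m y x"
  by (simp add: agree_def)

lemma agree_case_nat: "agree m x y \<Longrightarrow> agree (Suc m) (case_nat i x) (case_nat i y)"
  by (auto simp: agree_def split: nat.splits)

lemma shift_map_case_nat [simp]: "shift_map (case_nat i x) = x"
  by (simp add: shift_map_def)

lemma funpow_shift_map: "(shift_map ^^ n) x k = x (k + n)"
  by (induction n arbitrary: k) (simp_all add: shift_map_def)

text \<open>
  The preimages of \<open>x\<close> under the shift are the sequences \<open>i x\<close>, so the operator is a sum over letters.
\<close>

lemma transfer_op_alt: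
  "transfer_op \<phi> f x = (\<Sum>\<^sub>\<infinity>i. exp (\<phi> (case_nat i x)) * f (case_nat i x))"
proof -
  have "shift_map -` {x} = range (\<lambda>i. case_nat i x)"
  proof (intro set_eqI iffI)
    fix t assume "t \<in> shift_map -` {x}"
    then have "t = case_nat (t 0) x"
      by (auto simp: shift_map_def fun_eq_iff split: nat.splits)
    then show "t \<in> range (\<lambda>i. case_nat i x)" by blast
  qed auto
  moreover have "inj (\<lambda>i. case_nat i x)"
    by (rule injI) (metis old.nat.simps(4))
  ultimately show ?thesis
    by (simp add: transfer_op_def infsum_reindex o_def)
qed

lemma birkhoff_sum_Suc_case_nat:
  "birkhoff_sum \<phi> (Suc n) (case_nat i y) = \<phi> (case_nat i y) + birkhoff_sum \<phi> n y"
proof -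
  have "(shift_map ^^ Suc j) (case_nat i y) = (shift_map ^^ j) y" for j
    by (simp add: funpow_swap1)
  then show ?thesis
    unfolding birkhoff_sum_def by (subst sum.lessThan_Suc_shift) simp
qed

definition prepend :: "nat list \<Rightarrow> seq \<Rightarrow> seq" where
  "prepend w x = foldr case_nat w x"

lemma prepend_simps [simp]: "prepend [] x = x" "prepend (i # w) x = case_nat i (prepend w x)"
  by (simp_all add: prepend_def)

lemma prepend_nth: "prepend w x k = (if k < length w then w ! k else x (k - length w))"
  by (induction w arbitrary: k) (auto split: nat.splits)

lemma agree_prepend: "agree (length w) (prepend w x) (prepend w y)"
  by (simp add: agree_def prepend_nth)

lemma cylinder_eq: "cylinder w = range (prepend w)"
proof (intro set_eqI iffI)
  fix t assume "t \<in> cylinder w"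
  then have "t = prepend w (\<lambda>k. t (k + length w))"
    by (auto simp: cylinder_def prepend_nth fun_eq_iff)
  then show "t \<in> range (prepend w)" by blast
qed (auto simp: cylinder_def prepend_nth)

definition words :: "nat \<Rightarrow> nat list set" where
  "words n = {w. length w = n}"

lemma words_0: "words 0 = {[]}"
  by (auto simp: words_def)

lemma words_Suc: "words (Suc n) = (\<lambda>(w, i). i # w) ` (words n \<times> UNIV)"
  by (auto simp: words_def length_Suc_conv image_iff)

lemma inj_Cons: "inj_on (\<lambda>(w, i). i # w) A"
  by (auto simp: inj_on_def)

section \<open>Continuity and functions of finitely many coordinates\<close>

lemma open_agree: "open {y. agree m x y}"
proof -
  have "{y. agree m x y} = (\<Inter>k\<in>{..<m}. (\<lambda>y. y k) -` {x k})"
    by (auto simp: agree_def)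
  moreover have "open ((\<lambda>y :: seq. y k) -` {x k})" for k
    by (rule open_vimage[OF discrete_topology_class.open_discrete continuous_on_product_coordinates])
  ultimately show ?thesis by auto
qed

lemma continuous_on_seqI:
  fixes f :: "seq \<Rightarrow> real"
  assumes "\<And>x e. 0 < e \<Longrightarrow> \<exists>m. \<forall>y. agree m x y \<longrightarrow> \<bar>f x - f y\<bar> < e"
  shows "continuous_on UNIV f"
proof -
  have "(f \<longlongrightarrow> f x) (at x)" for x
  proof (rule tendstoI)
    fix e :: real assume "0 < e"
    then obtain m where m: "\<forall>y. agree m x y \<longrightarrow> \<bar>f x - f y\<bar> < e" using assms by blast
    have "\<forall>\<^sub>F y in at x. y \<in> {y. agree m x y}"
      by (rule eventually_at_in_open') (auto simp: open_agree, simp add: agree_def)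
    then show "\<forall>\<^sub>F y in at x. dist (f y) (f x) < e"
      by eventually_elim (use m in \<open>auto simp: dist_real_def abs_minus_commute\<close>)
  qed
  then show ?thesis by (simp add: continuous_on_def)
qed

lemma uniformly_continuous_measurable:
  fixes f :: "seq \<Rightarrow> real"
  assumes uc: "\<And>e. 0 < e \<Longrightarrow> \<exists>m. \<forall>x y. agree m x y \<longrightarrow> \<bar>f x - f y\<bar> < e"
  shows "f \<in> borel_measurable borel"
  by (intro borel_measurable_continuous_onI continuous_on_seqI) (use uc in blast)

text \<open>
  These are the locally constant functions and clopen sets of finite depth. They play the role of
  simple functions: they are Hoelder continuous of every order, and measures are tested on them.
\<close>

definition depends :: "nat \<Rightarrow> (seq \<Rightarrow> 'b) \<Rightarrow> bool" where
  "depends m f \<longleftrightarrow> (\<forall>x y. agree m x y \<longrightarrow> f x = f y)"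

lemma dependsD: "depends m f \<Longrightarrow> agree m x y \<Longrightarrow> f x = f y"
  by (auto simp: depends_def)

lemma depends_borel:
  assumes "depends m (\<lambda>x. x \<in> E)"
  shows "E \<in> sets (borel :: seq measure)"
proof -
  have "E = (\<Union>x\<in>E. {y. agree m x y})"
    using assms agree_refl by (fastforce simp: depends_def)
  moreover have "open (\<Union>x\<in>E. {y. agree m x y})" by (intro open_UN ballI open_agree)
  ultimately show ?thesis by simp
qed

lemma depends_measurable:
  fixes f :: "seq \<Rightarrow> real"
  assumes "depends m f"
  shows "f \<in> borel_measurable borel"
  by (intro borel_measurable_continuous_onI continuous_on_seqI exI[of _ m])
    (use dependsD[OF assms] in fastforce)

lemma depends_indicator: "depends m (\<lambda>x. x \<in> E) \<Longrightarrow> depends m (indicat_real E)"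
  by (auto simp: depends_def indicator_def)

text \<open>
  Replacing the tail by zeros turns any function into one of finite depth. For continuous functions
  the result converges pointwise, for uniformly continuous ones uniformly.
\<close>

definition trunc :: "nat \<Rightarrow> seq \<Rightarrow> seq" where
  "trunc m x = (\<lambda>k. if k < m then x k else 0)"

lemma agree_trunc: "agree m x (trunc m x)"
  by (simp add: agree_def trunc_def)

lemma depends_trunc: "depends m (\<lambda>x. f (trunc m x))"
proof -
  have "trunc m x = trunc m y" if "agree m x y" for x y
    using that by (auto simp: trunc_def agree_def)
  then show ?thesis by (auto simp: depends_def)
qed

section \<open>Geometric rates and dominated sums\<close>

lemma tendsto_of_geometric_bound:
  fixes w :: "nat \<Rightarrow> real"
  assumes "0 < \<theta>" "\<theta> < 1" "\<And>n. \<bar>w n - l\<bar> \<le> C * \<theta> ^ n"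
  shows "w \<longlonglongrightarrow> l"
proof -
  have "(\<lambda>n. C * \<theta> ^ n) \<longlonglongrightarrow> C * 0"
    using assms(1,2) by (intro tendsto_mult_left LIMSEQ_realpow_zero) auto
  then have "(\<lambda>n. w n - l) \<longlonglongrightarrow> 0"
    using assms(3) by (intro Lim_null_comparison[of "\<lambda>n. w n - l" "\<lambda>n. C * \<theta> ^ n"]) auto
  then show ?thesis by (simp add: LIM_zero_iff)
qed

text \<open>
  The explicit rate is what turns one-step estimates into uniform exponential convergence:
  the constant does not depend on the sequence, only on the bound for its increments.
\<close>

lemma geometric_increments:
  fixes w :: "nat \<Rightarrow> real"
  assumes \<theta>: "0 < \<theta>" "\<theta> < 1" and step: "\<And>n. \<bar>w (Suc n) - w n\<bar> \<le> C * \<theta> ^ n"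
  obtains l where "\<And>n. \<bar>w n - l\<bar> \<le> C / (1 - \<theta>) * \<theta> ^ n"
proof -
  have C: "0 \<le> C" using step[of 0] by simp
  have "summable (\<lambda>n. C * \<theta> ^ n)"
    using \<theta> by (intro summable_mult summable_geometric) auto
  then have "summable (\<lambda>n. w (Suc n) - w n)"
    by (rule summable_comparison_test') (use step in auto)
  then obtain l where l: "w \<longlonglongrightarrow> l"
    by (auto simp: summable_iff_convergent sum_lessThan_telescope convergent_diff_const_right_iff
        convergent_def)
  have diff: "\<bar>w (n + k) - w n\<bar> \<le> C / (1 - \<theta>) * (1 - \<theta> ^ k) * \<theta> ^ n" for n k
  proof (induction k)
    case (Suc k)
    have "\<bar>w (n + Suc k) - w n\<bar> \<le> \<bar>w (Suc (n + k)) - w (n + k)\<bar> + \<bar>w (n + k) - w n\<bar>"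
      by simp
    also have "\<dots> \<le> C * \<theta> ^ (n + k) + C / (1 - \<theta>) * (1 - \<theta> ^ k) * \<theta> ^ n"
      by (intro add_mono step Suc)
    also have "\<dots> = C / (1 - \<theta>) * (1 - \<theta> ^ Suc k) * \<theta> ^ n"
      using \<theta> by (simp add: field_simps power_add)
    finally show ?case .
  qed simp
  have "\<bar>w n - l\<bar> \<le> C / (1 - \<theta>) * \<theta> ^ n" for n
  proof -
    have "(\<lambda>k. \<bar>w (k + n) - w n\<bar>) \<longlonglongrightarrow> \<bar>l - w n\<bar>"
      by (intro tendsto_intros LIMSEQ_ignore_initial_segment l)
    moreover have "\<bar>w (k + n) - w n\<bar> \<le> C / (1 - \<theta>) * \<theta> ^ n" for k
    proof -
      have "C / (1 - \<theta>) * (1 - \<theta> ^ k) * \<theta> ^ n \<le> C / (1 - \<theta>) * 1 * \<theta> ^ n"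
        using C \<theta> by (intro mult_right_mono mult_left_mono) auto
      with diff[of n k] show ?thesis by (simp add: add.commute)
    qed
    ultimately have "\<bar>l - w n\<bar> \<le> C / (1 - \<theta>) * \<theta> ^ n"
      by (intro LIMSEQ_le_const2) auto
    then show ?thesis by (simp add: abs_minus_commute)
  qed
  then show thesis by (rule that)
qed

lemma abs_ln_diff_le:
  fixes x y c :: real
  assumes "0 < c" "c \<le> x" "c \<le> y"
  shows "\<bar>ln x - ln y\<bar> \<le> \<bar>x - y\<bar> / c"
proof -
  have *: "ln x - ln y \<le> \<bar>x - y\<bar> / c" if "c \<le> x" "c \<le> y" for x y :: real
  proof -
    have "ln x - ln y = ln (x / y)" using that assms(1) by (simp add: ln_div)
    also have "\<dots> \<le> x / y - 1" using that assms(1) by (intro ln_le_minus_one) auto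
    also have "\<dots> = (x - y) / y" using that assms(1) by (simp add: field_simps)
    also have "\<dots> \<le> \<bar>x - y\<bar> / c"
      using that assms(1) by (intro frac_le) auto
    finally show ?thesis .
  qed
  show ?thesis using *[of x y] *[of y x] assms by (auto simp: abs_if abs_minus_commute split: if_splits)
qed

lemma abs_exp_diff_le:
  fixes x y C :: real
  assumes "\<bar>x\<bar> \<le> C" "\<bar>y\<bar> \<le> C"
  shows "\<bar>exp x - exp y\<bar> \<le> exp C * \<bar>x - y\<bar>"
proof -
  have *: "exp x - exp y \<le> exp C * \<bar>x - y\<bar>" if "x \<le> C" for x y :: real
  proof -
    have "exp x - exp y = exp x * (1 - exp (y - x))" by (simp add: right_diff_distrib mult_exp_exp)
    also have "\<dots> \<le> exp x * (x - y)"
      using exp_ge_add_one_self[of "y - x"] by (intro mult_left_mono) (linarith, simp)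
    also have "\<dots> \<le> exp x * \<bar>x - y\<bar>" by (intro mult_left_mono) auto
    also have "\<dots> \<le> exp C * \<bar>x - y\<bar>" using that by (intro mult_right_mono) auto
    finally show ?thesis .
  qed
  show ?thesis using *[of x y] *[of y x] assms by (auto simp: abs_if split: if_splits)
qed

lemma summable_on_real_integral:
  fixes f :: "'b \<Rightarrow> real"
  assumes "f summable_on A"
  shows "integrable (count_space A) f" "infsum f A = integral\<^sup>L (count_space A) f"
proof -
  have "Infinite_Set_Sum.abs_summable_on f A"
    using assms summable_on_iff_abs_summable_on_real abs_summable_equivalent by metis
  then show "integrable (count_space A) f" "infsum f A = integral\<^sup>L (count_space A) f"
    using infsetsum_infsum[of f A] by (simp_all add: Infinite_Set_Sum.abs_summable_on_def infsetsum_def)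
qed

lemma summable_on_real_dominated:
  fixes f g :: "'b \<Rightarrow> real"
  assumes "g summable_on A" "\<And>x. x \<in> A \<Longrightarrow> \<bar>f x\<bar> \<le> g x"
  shows "f summable_on A"
proof -
  have "(\<lambda>x. norm (g x)) summable_on A"
    by (rule summable_on_iff_abs_summable_on_real[THEN iffD1, OF assms(1)])
  then have "(\<lambda>x. norm (f x)) summable_on A"
    by (rule Infinite_Sum.abs_summable_on_comparison_test) (use assms(2) in force)
  then show ?thesis by (rule summable_on_iff_abs_summable_on_real[THEN iffD2])
qed

text \<open>
  The sum is an integral for the counting measure, so this is Lebesgue's theorem.
\<close>

lemma infsum_dominated_tendsto:
  fixes f :: "nat \<Rightarrow> 'b \<Rightarrow> real"
  assumes g: "g summable_on A" and le: "\<And>N x. x \<in> A \<Longrightarrow> \<bar>f N x\<bar> \<le> g x"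
    and lim: "\<And>x. x \<in> A \<Longrightarrow> (\<lambda>N. f N x) \<longlonglongrightarrow> F x"
  shows "(\<lambda>N. infsum (f N) A) \<longlonglongrightarrow> infsum F A"
proof -
  have Fle: "\<bar>F x\<bar> \<le> g x" if "x \<in> A" for x
    using tendsto_rabs[OF lim[OF that]] le[OF that] by (intro LIMSEQ_le_const2) auto
  have f: "f N summable_on A" for N by (rule summable_on_real_dominated[OF g le])
  have F: "F summable_on A" by (rule summable_on_real_dominated[OF g Fle])
  have "(\<lambda>N. integral\<^sup>L (count_space A) (f N)) \<longlonglongrightarrow> integral\<^sup>L (count_space A) F"
    by (rule integral_dominated_convergence[where w = g])
      (use le lim summable_on_real_integral(1)[OF g] in \<open>auto simp: AE_count_space\<close>)
  then show ?thesis
    by (simp add: summable_on_real_integral(2)[OF f] summable_on_real_integral(2)[OF F])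
qed

section \<open>The transfer operator of a Hoelder potential\<close>

text \<open>
  The Hoelder condition starts at \<open>n = 1\<close>, so \<open>\<phi>\<close> may tend to minus infinity along the letters, as it
  must for the series to converge. On one cylinder of length one its values differ by at most \<open>K\<close>;
  pointwise summability therefore bounds the series uniformly in \<open>x\<close>.
\<close>

locale holder_potential =
  fixes \<phi> :: "seq \<Rightarrow> real" and r K :: real
  assumes r_pos: "0 < r" and r_less_1: "r < 1" and K_nonneg: "0 \<le> K"
    and holder: "\<And>n x y. 1 \<le> n \<Longrightarrow> agree n x y \<Longrightarrow> \<bar>\<phi> x - \<phi> y\<bar> \<le> K * r ^ n"
    and summable_exp: "\<And>x. (\<lambda>i. exp (\<phi> (case_nat i x))) summable_on UNIV"

begin

abbreviation L :: "(seq \<Rightarrow> real) \<Rightarrow> seq \<Rightarrow> real" where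
  "L \<equiv> transfer_op \<phi>"

abbreviation one :: "seq \<Rightarrow> real" where "one \<equiv> (\<lambda>_. 1)"

lemma r_power_le_1: "r ^ n \<le> 1"
  using r_pos r_less_1 by (simp add: power_le_one)

lemma exp_case_nat_le:
  assumes "agree m x y"
  shows "exp (\<phi> (case_nat i x)) \<le> exp (K * r ^ Suc m) * exp (\<phi> (case_nat i y))"
  using holder[of "Suc m" "case_nat i x" "case_nat i y"] agree_case_nat[OF assms, of i]
  by (simp add: mult_exp_exp)

text \<open>
  On the cylinder of the letter \<open>i\<close> the point \<open>i 0 0 ...\<close> controls all others up to the factor \<open>exp K\<close>;
  the resulting bound on \<open>exp (\<phi> (i x))\<close> is summable over \<open>i\<close>.
\<close>

definition letter_bound :: "nat \<Rightarrow> real" where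
  "letter_bound i = exp K * exp (\<phi> (case_nat i (\<lambda>_. 0)))"

lemma letter_bound_pos: "0 < letter_bound i"
  by (simp add: letter_bound_def)

lemma exp_le_letter_bound: "exp (\<phi> (case_nat i x)) \<le> letter_bound i"
proof -
  have "exp (K * r ^ Suc 0) \<le> exp K"
    using K_nonneg r_less_1 mult_left_mono[of r 1 K] by simp
  then have "exp (K * r ^ Suc 0) * exp (\<phi> (case_nat i (\<lambda>_. 0))) \<le> letter_bound i"
    unfolding letter_bound_def by (intro mult_right_mono) auto
  with exp_case_nat_le[OF agree_0, of i x "\<lambda>_. 0"] show ?thesis by linarith
qed

lemma summable_letter_bound: "letter_bound summable_on UNIV"
  unfolding letter_bound_def[abs_def] by (intro summable_on_cmult_right summable_exp)

definition S :: real where "S = infsum letter_bound UNIV"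

lemma summable_letter_bound_mult: "(\<lambda>i. letter_bound i * B) summable_on UNIV"
  by (intro summable_on_cmult_left summable_letter_bound)

lemma abs_exp_mult_le:
  assumes "\<And>x. \<bar>f x\<bar> \<le> B"
  shows "\<bar>exp (\<phi> (case_nat i x)) * f (case_nat i x)\<bar> \<le> letter_bound i * B"
  using assms letter_bound_pos[of i] exp_le_letter_bound[of i x]
  by (auto simp: abs_mult less_imp_le intro!: mult_mono)

lemma summable_L:
  assumes "\<And>x. \<bar>f x\<bar> \<le> B"
  shows "(\<lambda>i. exp (\<phi> (case_nat i x)) * f (case_nat i x)) summable_on UNIV"
proof -
  have "(\<lambda>i. norm (letter_bound i * B)) summable_on UNIV"
    by (rule summable_on_iff_abs_summable_on_real[THEN iffD1, OF summable_letter_bound_mult])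
  then have "(\<lambda>i. norm (exp (\<phi> (case_nat i x)) * f (case_nat i x))) summable_on UNIV"
  proof (rule Infinite_Sum.abs_summable_on_comparison_test)
    show "norm (exp (\<phi> (case_nat i x)) * f (case_nat i x)) \<le> norm (letter_bound i * B)" for i
      using abs_exp_mult_le[of f B i x, OF assms] by simp
  qed
  then show ?thesis by (rule summable_on_iff_abs_summable_on_real[THEN iffD2])
qed

lemma L_mono:
  assumes "\<And>x. \<bar>f x\<bar> \<le> B" "\<And>x. \<bar>g x\<bar> \<le> B'" "\<And>x. f x \<le> g x"
  shows "L f x \<le> L g x"
  unfolding transfer_op_alt
  by (intro infsum_mono summable_L[of f B] summable_L[of g B'] mult_left_mono assms) auto

lemma L_add:
  assumes "\<And>x. \<bar>f x\<bar> \<le> B" "\<And>x. \<bar>g x\<bar> \<le> B'"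
  shows "L (\<lambda>x. f x + g x) x = L f x + L g x"
  unfolding transfer_op_alt distrib_left
  by (intro infsum_add summable_L[of f B] summable_L[of g B'] assms)

lemma L_scale: "L (\<lambda>x. c * f x) x = c * L f x"
  unfolding transfer_op_alt
  by (subst infsum_cmult_right'[symmetric]) (simp add: mult_ac)

lemma L_bound:
  assumes "\<And>x. \<bar>f x\<bar> \<le> B"
  shows "\<bar>L f x\<bar> \<le> S * B"
proof -
  have "norm (L f x) \<le> (\<Sum>\<^sub>\<infinity>i. letter_bound i * B)"
    unfolding transfer_op_alt
  proof (rule norm_infsum_le)
    show "((\<lambda>i. exp (\<phi> (case_nat i x)) * f (case_nat i x)) has_sum
      (\<Sum>\<^sub>\<infinity>i. exp (\<phi> (case_nat i x)) * f (case_nat i x))) UNIV"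
      by (rule has_sum_infsum[OF summable_L[OF assms]])
    show "((\<lambda>i. letter_bound i * B) has_sum (\<Sum>\<^sub>\<infinity>i. letter_bound i * B)) UNIV"
      by (rule has_sum_infsum[OF summable_letter_bound_mult])
  qed (use abs_exp_mult_le[OF assms] in simp)
  also have "\<dots> = S * B" unfolding S_def by (rule infsum_cmult_left')
  finally show ?thesis by simp
qed

lemma L_pos:
  assumes "\<And>x. \<bar>f x\<bar> \<le> B" "\<And>x. 0 < f x"
  shows "0 < L f x"
proof -
  have "sum (\<lambda>i. exp (\<phi> (case_nat i x)) * f (case_nat i x)) {0} \<le> L f x"
    unfolding transfer_op_alt using assms(2)
    by (intro finite_sum_le_infsum summable_L[OF assms(1)]) (auto intro!: less_imp_le)
  with assms(2) show ?thesis by (smt (verit) exp_gt_zero finite.intros mult_pos_pos sum.insert sum.empty empty_iff)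
qed

lemma L_diff_le:
  assumes "\<And>x. \<bar>f x\<bar> \<le> B" "\<And>x. \<bar>g x\<bar> \<le> B'" "\<And>x. \<bar>f x - g x\<bar> \<le> e"
  shows "\<bar>L f x - L g x\<bar> \<le> S * e"
proof -
  have g': "\<bar>- 1 * g x\<bar> \<le> B'" for x using assms(2)[of x] by simp
  have "L (\<lambda>x. f x + (- 1) * g x) x = L f x + (- 1) * L g x"
    unfolding L_add[OF assms(1) g'] L_scale ..
  moreover have "\<bar>L (\<lambda>x. f x + (- 1) * g x) x\<bar> \<le> S * e"
    by (rule L_bound) (use assms(3) in simp)
  ultimately show ?thesis by simp
qed

lemma Lpow_Suc: "(L ^^ Suc n) f = L ((L ^^ n) f)"
  by simp

lemma Lpow_bound:
  assumes "\<And>x. \<bar>f x\<bar> \<le> B"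
  shows "\<bar>(L ^^ n) f x\<bar> \<le> S ^ n * B"
proof (induction n arbitrary: x)
  case (Suc n)
  have "\<bar>L ((L ^^ n) f) x\<bar> \<le> S * (S ^ n * B)" by (rule L_bound) (rule Suc)
  then show ?case by (simp add: mult_ac)
qed (simp add: assms)

lemma Lpow_mono:
  assumes "\<And>x. \<bar>f x\<bar> \<le> B" "\<And>x. \<bar>g x\<bar> \<le> B'" "\<And>x. f x \<le> g x"
  shows "(L ^^ n) f x \<le> (L ^^ n) g x"
proof (induction n arbitrary: x)
  case (Suc n)
  show ?case unfolding Lpow_Suc
    by (rule L_mono[OF Lpow_bound[OF assms(1)] Lpow_bound[OF assms(2)] Suc])
qed (simp add: assms)

lemma Lpow_add:
  assumes "\<And>x. \<bar>f x\<bar> \<le> B" "\<And>x. \<bar>g x\<bar> \<le> B'"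
  shows "(L ^^ n) (\<lambda>x. f x + g x) x = (L ^^ n) f x + (L ^^ n) g x"
proof (induction n arbitrary: x)
  case (Suc n)
  then have "(L ^^ n) (\<lambda>x. f x + g x) = (\<lambda>x. (L ^^ n) f x + (L ^^ n) g x)" by blast
  then show ?case unfolding Lpow_Suc
    by (simp add: L_add[OF Lpow_bound[OF assms(1)] Lpow_bound[OF assms(2)]])
qed simp

lemma Lpow_scale: "(L ^^ n) (\<lambda>x. c * f x) x = c * (L ^^ n) f x"
proof (induction n arbitrary: x)
  case (Suc n)
  then have "(L ^^ n) (\<lambda>x. c * f x) = (\<lambda>x. c * (L ^^ n) f x)" by blast
  then show ?case unfolding Lpow_Suc by (simp add: L_scale)
qed simp

lemma Lpow_diff_le:
  assumes f: "\<And>x. \<bar>f x\<bar> \<le> B" and g: "\<And>x. \<bar>g x\<bar> \<le> B'" and le: "\<And>x. \<bar>f x - g x\<bar> \<le> e"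
  shows "\<bar>(L ^^ n) f x - (L ^^ n) g x\<bar> \<le> e * (L ^^ n) one x"
proof -
  have e: "\<bar>e * one x\<bar> \<le> \<bar>e\<bar>" for x by simp
  have *: "(L ^^ n) f x \<le> (L ^^ n) g x + e * (L ^^ n) one x"
    if f: "\<And>x. \<bar>f x\<bar> \<le> B" and g: "\<And>x. \<bar>g x\<bar> \<le> B'" and le: "\<And>x. f x \<le> g x + e * one x" for f g B B'
  proof -
    have ge: "\<bar>g x + e * one x\<bar> \<le> B' + \<bar>e\<bar>" for x
      using g[of x] abs_triangle_ineq[of "g x" e] by simp
    have "(L ^^ n) f x \<le> (L ^^ n) (\<lambda>x. g x + e * one x) x" by (rule Lpow_mono[OF f ge le])
    also have "\<dots> = (L ^^ n) g x + (L ^^ n) (\<lambda>x. e * one x) x" by (rule Lpow_add[OF g e])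
    finally show ?thesis unfolding Lpow_scale .
  qed
  have 1: "f x \<le> g x + e * one x" and 2: "g x \<le> f x + e * one x" for x using le[of x] by linarith+
  show ?thesis using *[of f B g B', OF f g 1] *[of g B' f B, OF g f 2] by linarith
qed

section \<open>Contraction on an invariant cone\<close>

text \<open>
  Positive functions whose logarithm is \<open>a\<close>-Lipschitz. The case \<open>m = 0\<close> is deliberately included: it
  bounds the ratio of any two values by \<open>exp a\<close>, so membership also controls the oscillation on the
  whole space, although the space is not compact.
\<close>

definition cone :: "real \<Rightarrow> (seq \<Rightarrow> real) set" where
  "cone a = {f. (\<forall>x. 0 < f x) \<and> (\<forall>m x y. agree m x y \<longrightarrow> f x \<le> exp (a * r ^ m) * f y)}"

lemma coneD:
  assumes "f \<in> cone a"
  shows "0 < f x" "agree m x y \<Longrightarrow> f x \<le> exp (a * r ^ m) * f y"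
  using assms by (auto simp: cone_def)

lemma cone_le: "f \<in> cone a \<Longrightarrow> f x \<le> exp a * f y"
  using coneD(2)[of f a 0 x y] by simp

lemma cone_bound: "f \<in> cone a \<Longrightarrow> \<bar>f x\<bar> \<le> exp a * f (\<lambda>_. 0)"
  using coneD(1)[of f a x] cone_le[of f a x] by simp

lemma cone_mono: "a \<le> b \<Longrightarrow> f \<in> cone a \<Longrightarrow> f \<in> cone b"
proof -
  assume ab: "a \<le> b" and f: "f \<in> cone a"
  have "f x \<le> exp (b * r ^ m) * f y" if "agree m x y" for m x y
  proof -
    have "exp (a * r ^ m) * f y \<le> exp (b * r ^ m) * f y"
      using ab r_pos coneD(1)[OF f, of y] by (intro mult_right_mono) auto
    with coneD(2)[OF f that] show ?thesis by linarith
  qed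
  with coneD(1)[OF f] show "f \<in> cone b" by (simp add: cone_def)
qed

lemma one_in_cone: "0 \<le> a \<Longrightarrow> (\<lambda>_. 1) \<in> cone a"
  using r_pos by (auto simp: cone_def)

text \<open>
  Prepending a letter shrinks distances by the factor \<open>r\<close>. Each summand therefore has log-Lipschitz
  constant at most \<open>(a + K) r\<close>, and a sum of functions in a cone stays in the cone.
\<close>

lemma L_cone:
  assumes f: "f \<in> cone a"
  shows "L f \<in> cone ((a + K) * r)"
proof -
  note fb = cone_bound[OF f]
  have "L f x \<le> exp ((a + K) * r * r ^ m) * L f y" if "agree m x y" for m x y
  proof -
    have "exp (\<phi> (case_nat i x)) * f (case_nat i x)
        \<le> exp ((a + K) * r * r ^ m) * (exp (\<phi> (case_nat i y)) * f (case_nat i y))" for i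
    proof -
      have "exp (\<phi> (case_nat i x)) * f (case_nat i x)
        \<le> (exp (K * r ^ Suc m) * exp (\<phi> (case_nat i y))) * (exp (a * r ^ Suc m) * f (case_nat i y))"
        using coneD[OF f] agree_case_nat[OF that, of i]
        by (intro mult_mono exp_case_nat_le that) (auto simp: less_imp_le simp del: power_Suc)
      also have "\<dots> = (exp (K * r ^ Suc m) * exp (a * r ^ Suc m)) * (exp (\<phi> (case_nat i y)) * f (case_nat i y))"
        by (simp only: mult_ac)
      also have "exp (K * r ^ Suc m) * exp (a * r ^ Suc m) = exp ((a + K) * r * r ^ m)"
        by (simp add: mult_exp_exp algebra_simps)
      finally show ?thesis .
    qed
    then show ?thesis
      unfolding transfer_op_alt
      by (subst infsum_cmult_right'[symmetric])
        (intro infsum_mono summable_L[OF fb] summable_on_cmult_right)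
  qed
  with L_pos[OF fb] coneD(1)[OF f] show ?thesis by (simp add: cone_def)
qed

text \<open>
  The constant is chosen so that \<open>(a + K) r = a - r\<close>: the operator then maps the cone with constant
  \<open>a\<close> into the strictly smaller cone with constant \<open>a'\<close>, and the gap is explicit.
\<close>

definition a :: real where "a = (K + 1) * r / (1 - r)"

definition a' :: real where "a' = (a + K) * r"

lemma a'_eq: "a' = a - r"
  using r_less_1 by (simp add: a'_def a_def field_simps)

lemma a'_pos: "0 < a'" and a_pos: "0 < a"
  using r_pos r_less_1 K_nonneg by (auto simp: a'_def a_def intro!: mult_pos_pos add_pos_nonneg)

lemma a'_less: "a' < a"
  using a'_eq r_pos by simp

lemma L_cone_a: "f \<in> cone a \<Longrightarrow> L f \<in> cone a'"
  using L_cone[of f a] by (simp add: a'_def)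

lemma L_cone_a_a: "f \<in> cone a \<Longrightarrow> L f \<in> cone a"
  using L_cone_a cone_mono a'_less by (meson less_imp_le)

lemma Lpow_cone: "f \<in> cone a \<Longrightarrow> (L ^^ n) f \<in> cone a"
  by (induction n) (auto intro: L_cone_a_a)

lemma one_cone: "one \<in> cone a"
  using a_pos by (intro one_in_cone) simp

lemma Lpow_one_pos: "0 < (L ^^ n) one x"
  by (rule coneD(1)[OF Lpow_cone[OF one_cone]])

definition \<kappa> :: real where "\<kappa> = (a + a') * exp a / (a - a')"

lemma \<kappa>_gt_1: "1 < \<kappa>"
proof -
  have "1 < exp a" using a_pos by simp
  then have "(a - a') * 1 < (a + a') * exp a"
    using a'_pos a'_less by (intro mult_strict_mono) auto
  then show ?thesis using a'_less by (simp add: \<kappa>_def field_simps)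
qed

text \<open>
  The gap between the two cones leaves room to subtract. With \<open>u = r ^ m\<close>, both
  \<open>exp (a u) - exp (- a' u)\<close> and \<open>exp (a u) - exp (a' u)\<close> are of order \<open>u\<close>; \<open>\<kappa>\<close> bounds the quotient of
  the first by the second, uniformly in \<open>m\<close>.
\<close>

lemma cone_diff:
  assumes F: "F \<in> cone a'" and G: "G \<in> cone a'" and "0 \<le> t"
    and le: "\<And>y. \<kappa> * (t * G y) \<le> F y"
  shows "(\<lambda>x. F x - t * G x) \<in> cone a"
proof -
  have pos: "0 < F x - t * G x" for x
  proof (cases "t = 0")
    case False
    then have "1 * (t * G x) < \<kappa> * (t * G x)"
      using \<kappa>_gt_1 coneD(1)[OF G, of x] \<open>0 \<le> t\<close> by (intro mult_strict_right_mono) auto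
    with le[of x] show ?thesis by simp
  qed (use coneD(1)[OF F] in simp)
  have "F x - t * G x \<le> exp (a * r ^ m) * (F y - t * G y)" if xy: "agree m x y" for m x y
  proof -
    define u where "u = r ^ m"
    have u: "0 < u" "u \<le> 1" using r_pos r_power_le_1 by (auto simp: u_def)
    have GG: "exp (- (a' * u)) * G y \<le> G x"
      using coneD(2)[OF G agree_sym[OF xy]] by (simp add: u_def exp_minus field_simps)
    have FF: "F x \<le> exp (a' * u) * F y"
      using coneD(2)[OF F xy] by (simp add: u_def)
    have e1: "exp (a * u) - exp (- (a' * u)) \<le> (a + a') * exp a * u"
    proof -
      have "1 - exp (- ((a + a') * u)) \<le> (a + a') * u"
        using exp_ge_add_one_self[of "- ((a + a') * u)"] by linarith
      then have "exp (a * u) * (1 - exp (- ((a + a') * u))) \<le> exp (a * u) * ((a + a') * u)"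
        by (intro mult_left_mono) auto
      also have "\<dots> \<le> exp a * ((a + a') * u)"
        using u a_pos a'_pos by (intro mult_right_mono) auto
      finally show ?thesis
        by (simp add: right_diff_distrib mult_exp_exp algebra_simps)
    qed
    have e2: "(a - a') * u \<le> exp (a * u) - exp (a' * u)"
    proof -
      have "(a - a') * u \<le> exp ((a - a') * u) - 1"
        using exp_ge_add_one_self[of "(a - a') * u"] by linarith
      also have "\<dots> \<le> exp (a' * u) * (exp ((a - a') * u) - 1)"
        using u a'_pos a'_less mult_right_mono[of 1 "exp (a' * u)" "exp ((a - a') * u) - 1"] by simp
      finally show ?thesis
        by (simp add: right_diff_distrib mult_exp_exp algebra_simps)
    qed
    have "t * G y * (exp (a * u) - exp (- (a' * u))) \<le> t * G y * ((a + a') * exp a * u)"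
      using e1 \<open>0 \<le> t\<close> coneD(1)[OF G, of y] by (intro mult_left_mono) auto
    also have "\<dots> = \<kappa> * (t * G y) * ((a - a') * u)"
      using a'_less by (simp add: \<kappa>_def)
    also have "\<dots> \<le> F y * (exp (a * u) - exp (a' * u))"
      using e2 le[of y] a'_less u coneD(1)[OF F, of y] by (intro mult_mono) (auto intro: less_imp_le)
    finally have *: "t * G y * (exp (a * u) - exp (- (a' * u))) \<le> F y * (exp (a * u) - exp (a' * u))" .
    have "F x - t * G x \<le> exp (a' * u) * F y - t * (exp (- (a' * u)) * G y)"
      using FF GG \<open>0 \<le> t\<close> by (intro diff_mono mult_left_mono) auto
    also have "\<dots> \<le> exp (a * u) * (F y - t * G y)"
      using * by (simp add: algebra_simps)
    finally show ?thesis by (simp add: u_def)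
  qed
  with pos show ?thesis by (simp add: cone_def)
qed

definition \<theta> :: real where "\<theta> = 1 - exp (- 4 * a) / \<kappa>"

lemma \<theta>_bounds: "0 < \<theta>" "\<theta> < 1"
proof -
  have "exp (- 4 * a) < 1" using a_pos by simp
  then have "exp (- 4 * a) < \<kappa>" using \<kappa>_gt_1 by linarith
  then show "0 < \<theta>" "\<theta> < 1" using \<kappa>_gt_1 by (auto simp: \<theta>_def)
qed

text \<open>
  A Doeblin-type minorization: a fixed proportion of \<open>F\<close> is a multiple of \<open>G\<close>, and what remains is again
  in the cone. The values of \<open>F\<close> and \<open>G\<close> at a single point suffice to choose \<open>t\<close>, since both functions
  vary by at most the factor \<open>exp a\<close>.
\<close>

lemma cone_split:
  assumes F: "F \<in> cone a'" and G: "G \<in> cone a'"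
  obtains t where "0 \<le> t" "(\<lambda>x. F x - t * G x) \<in> cone a" "\<And>x. F x - t * G x \<le> \<theta> * F x"
proof -
  define z :: seq where "z = (\<lambda>_. 0)"
  note F' = cone_mono[OF less_imp_le[OF a'_less] F] and G' = cone_mono[OF less_imp_le[OF a'_less] G]
  note pos = coneD(1)[OF F] coneD(1)[OF G]
  \<comment> \<open>The factor \<open>exp (- 2 * a)\<close> compensates for the oscillation of \<open>F\<close> and of \<open>G\<close> between \<open>z\<close> and other points.\<close>
  define t where "t = exp (- 2 * a) * F z / (\<kappa> * G z)"
  have t: "0 \<le> t" using pos[of z] \<kappa>_gt_1 by (simp add: t_def less_imp_le)
  have 1: "\<kappa> * (t * G y) \<le> F y" for y
  proof -
    have "\<kappa> * (t * G y) = exp (- 2 * a) * F z * (G y / G z)"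
      using pos[of z] \<kappa>_gt_1 by (simp add: t_def)
    also have "\<dots> \<le> exp (- 2 * a) * (exp a * F y) * exp a"
      using pos[of z] pos[of y] cone_le[OF F', of z y] cone_le[OF G', of y z]
      by (intro mult_mono) (auto simp: field_simps less_imp_le)
    also have "\<dots> = F y" by (simp add: mult_exp_exp mult_ac flip: mult.assoc)
    finally show ?thesis .
  qed
  have 2: "F x - t * G x \<le> \<theta> * F x" for x
  proof -
    have "exp (- 4 * a) / \<kappa> * F x \<le> exp (- 4 * a) / \<kappa> * (exp a * F z) * (exp a * G x / G z)"
    proof -
      have "1 \<le> exp a * G x / G z" using cone_le[OF G', of z x] pos[of z] by simp
      then have "exp (- 4 * a) / \<kappa> * F x * 1 \<le> exp (- 4 * a) / \<kappa> * (exp a * F z) * (exp a * G x / G z)"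
        using cone_le[OF F', of x z] pos \<kappa>_gt_1
        by (intro mult_mono mult_left_mono) (auto simp: less_imp_le)
      then show ?thesis by simp
    qed
    also have "\<dots> = (exp (- 4 * a) * exp a * exp a) * F z / (\<kappa> * G z) * G x"
      by simp
    also have "\<dots> = t * G x"
      by (simp add: t_def mult_exp_exp)
    finally show ?thesis by (simp add: \<theta>_def algebra_simps)
  qed
  show thesis by (rule that[OF t cone_diff[OF F G t 1] 2])
qed

text \<open>
  Splitting off a multiple of \<open>L ^^ n g\<close> at every step, the part of \<open>L ^^ n f\<close> that is not yet
  proportional to \<open>L ^^ n g\<close> shrinks geometrically. This is an elementary form of
  Birkhoff's contraction of the Hilbert metric.
\<close>

lemma Lpow_split:
  assumes f: "f \<in> cone a" and g: "g \<in> cone a"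
  shows "\<exists>s\<ge>0. \<exists>q \<in> cone a. \<forall>x. (L ^^ n) f x = s * (L ^^ n) g x + q x \<and> q x \<le> \<theta> ^ n * (L ^^ n) f x"
proof (induction n)
  case 0
  show ?case by (rule exI[of _ 0]) (use f in auto)
next
  case (Suc n)
  then obtain s q where s: "0 \<le> s" and q: "q \<in> cone a"
    and both: "\<forall>x. (L ^^ n) f x = s * (L ^^ n) g x + q x \<and> q x \<le> \<theta> ^ n * (L ^^ n) f x"
    by (elim exE bexE conjE)
  note eq = both[THEN spec, THEN conjunct1] and le = both[THEN spec, THEN conjunct2]
  obtain t where t: "0 \<le> t" "(\<lambda>x. L q x - t * L ((L ^^ n) g) x) \<in> cone a"
    "\<And>x. L q x - t * L ((L ^^ n) g) x \<le> \<theta> * L q x"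
    by (rule cone_split[OF L_cone_a[OF q] L_cone_a[OF Lpow_cone[OF g, of n]]]) (rule that)
  have gb: "\<bar>s * (L ^^ n) g x\<bar> \<le> s * (exp a * (L ^^ n) g (\<lambda>_. 0))" for x
    using cone_bound[OF Lpow_cone[OF g]] s by (simp add: abs_mult mult_left_mono)
  have "(L ^^ n) f = (\<lambda>x. s * (L ^^ n) g x + q x)" by (rule ext) (rule eq)
  then have "L ((L ^^ n) f) x = s * L ((L ^^ n) g) x + L q x" for x
    using L_add[OF gb cone_bound[OF q]] by (simp add: L_scale)
  then have e: "(L ^^ Suc n) f x = (s + t) * (L ^^ Suc n) g x + (L q x - t * L ((L ^^ n) g) x)" for x
    by (simp add: algebra_simps)
  have fb: "\<bar>\<theta> ^ n * (L ^^ n) f x\<bar> \<le> \<theta> ^ n * (exp a * (L ^^ n) f (\<lambda>_. 0))" for x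
    using cone_bound[OF Lpow_cone[OF f]] \<theta>_bounds by (simp add: abs_mult mult_left_mono)
  have last: "L q x - t * L ((L ^^ n) g) x \<le> \<theta> ^ Suc n * (L ^^ Suc n) f x" for x
  proof -
    have "L q x \<le> \<theta> ^ n * L ((L ^^ n) f) x"
      using L_mono[OF cone_bound[OF q] fb le] by (simp only: L_scale)
    then have "\<theta> * L q x \<le> \<theta> * (\<theta> ^ n * L ((L ^^ n) f) x)"
      using \<theta>_bounds by (intro mult_left_mono) auto
    with t(3)[of x] show ?thesis by (simp add: mult.assoc)
  qed
  show ?case
    using e last s t(1,2)
    by (intro exI[of _ "s + t"] conjI bexI[of _ "\<lambda>x. L q x - t * L ((L ^^ n) g) x"] allI) auto
qed

text \<open>
  Bounds of the form \<open>s g \<le> f \<le> t g\<close> survive the positive operator \<open>L\<close>. The ranges of the ratios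
  are thus nested intervals, and by the splitting their lengths decay like \<open>\<theta> ^ n\<close>.
\<close>

lemma ratio_limit:
  assumes f: "f \<in> cone a" and g: "g \<in> cone a"
  obtains q B c where "0 < c" "0 \<le> B" "c \<le> q"
    "\<And>n x. c \<le> (L ^^ n) f x / (L ^^ n) g x"
    "\<And>n x. \<bar>(L ^^ n) f x / (L ^^ n) g x - q\<bar> \<le> B * \<theta> ^ n"
proof -
  define z :: seq where "z = (\<lambda>_. 0)"
  define R where "R n x = (L ^^ n) f x / (L ^^ n) g x" for n x
  note fn = Lpow_cone[OF f] and gn = Lpow_cone[OF g]
  have gpos: "0 < (L ^^ n) g x" for n x by (rule coneD(1)[OF gn])
  have fz: "0 < f z" and gz: "0 < g z" using coneD(1) f g by auto
  have gb: "\<bar>s * (L ^^ n) g x\<bar> \<le> \<bar>s\<bar> * (exp a * (L ^^ n) g (\<lambda>_. 0))" for s n x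
    using cone_bound[OF gn] by (simp add: abs_mult mult_left_mono)
  have low: "s \<le> R (n + k) x" if "\<And>x. s \<le> R n x" for s n k x
  proof -
    have "s * (L ^^ n) g x \<le> (L ^^ n) f x" for x
      using that[of x] gpos[of n x] by (simp add: R_def field_simps)
    then have "(L ^^ k) (\<lambda>x. s * (L ^^ n) g x) x \<le> (L ^^ k) ((L ^^ n) f) x"
      by (intro Lpow_mono[OF gb cone_bound[OF fn]])
    then have "s * (L ^^ (k + n)) g x \<le> (L ^^ (k + n)) f x"
      by (simp add: Lpow_scale funpow_add)
    then show ?thesis using gpos[of "k + n" x] by (simp add: R_def field_simps add.commute)
  qed
  have up: "R (n + k) x \<le> s" if "\<And>x. R n x \<le> s" for s n k x
  proof -
    have "(L ^^ n) f x \<le> s * (L ^^ n) g x" for x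
      using that[of x] gpos[of n x] by (simp add: R_def field_simps)
    then have "(L ^^ k) ((L ^^ n) f) x \<le> (L ^^ k) (\<lambda>x. s * (L ^^ n) g x) x"
      by (intro Lpow_mono[OF cone_bound[OF fn] gb])
    then have "(L ^^ (k + n)) f x \<le> s * (L ^^ (k + n)) g x"
      by (simp add: Lpow_scale funpow_add)
    then show ?thesis using gpos[of "k + n" x] by (simp add: R_def field_simps add.commute)
  qed
  \<comment> \<open>Both functions vary by at most the factor \<open>exp a\<close>, so at time \<open>0\<close> the ratio lies between \<open>c\<close> and \<open>B\<close>.\<close>
  define c where "c = exp (- 2 * a) * f z / g z"
  define B where "B = exp (2 * a) * f z / g z"
  have c: "0 < c" and B: "0 < B" using fz gz by (simp_all add: c_def B_def)
  have RB: "R n x \<le> B" for n x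
  proof -
    have "R 0 x \<le> B" for x
    proof -
      have "f x / g x \<le> (exp a * f z) / (exp (- a) * g z)"
        using cone_le[OF f, of x z] cone_le[OF g, of z x] fz gz coneD(1)[OF f, of x]
        by (intro frac_le) (auto simp: exp_minus field_simps)
      also have "\<dots> = B" by (simp add: B_def exp_minus field_simps mult_exp_exp)
      finally show ?thesis by (simp add: R_def)
    qed
    from up[of 0, OF this, of n] show ?thesis by simp
  qed
  have Rc: "c \<le> R n x" for n x
  proof -
    have "c \<le> R 0 x" for x
    proof -
      have "c = (exp (- a) * f z) / (exp a * g z)" by (simp add: c_def exp_minus field_simps mult_exp_exp)
      also have "\<dots> \<le> f x / g x"
        using cone_le[OF f, of z x] cone_le[OF g, of x z] fz gz coneD(1)[OF f, of x] coneD(1)[OF g, of x]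
        by (intro frac_le) (auto simp: exp_minus field_simps)
      finally show ?thesis by (simp add: R_def)
    qed
    from low[of _ 0, OF this, of n] show ?thesis by simp
  qed
  \<comment> \<open>The remainder of the splitting is at most \<open>\<theta> ^ n\<close> times \<open>L ^^ n f\<close>, hence at most \<open>B \<theta> ^ n\<close> times \<open>L ^^ n g\<close>.\<close>
  have osc: "\<exists>s. \<forall>x. s \<le> R n x \<and> R n x \<le> s + B * \<theta> ^ n" for n
  proof -
    obtain s q where s: "0 \<le> s" "q \<in> cone a" and *: "\<forall>x. (L ^^ n) f x = s * (L ^^ n) g x + q x \<and> q x \<le> \<theta> ^ n * (L ^^ n) f x"
      using Lpow_split[OF f g, of n] by (elim exE bexE conjE)
    have "s \<le> R n x \<and> R n x \<le> s + B * \<theta> ^ n" for x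
    proof -
      have eq: "(L ^^ n) f x = s * (L ^^ n) g x + q x" and le: "q x \<le> \<theta> ^ n * (L ^^ n) f x"
        using *[THEN spec, of x] by (rule conjunct1, rule conjunct2)
      have R: "R n x = s + q x / (L ^^ n) g x"
        using gpos[of n x] by (simp add: R_def eq field_simps)
      have "q x / (L ^^ n) g x \<le> \<theta> ^ n * R n x"
        using le gpos[of n x] by (simp add: R_def divide_right_mono less_imp_le)
      also have "\<dots> \<le> \<theta> ^ n * B" using RB \<theta>_bounds by (intro mult_left_mono) auto
      finally show ?thesis
        using R coneD(1)[OF s(2), of x] gpos[of n x] by (simp add: mult.commute less_imp_le)
    qed
    then show ?thesis by blast
  qed
  have "\<bar>R (Suc n) z - R n z\<bar> \<le> B * \<theta> ^ n" for n
  proof -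
    obtain s where s: "\<forall>x. s \<le> R n x \<and> R n x \<le> s + B * \<theta> ^ n" using osc[of n] by (elim exE)
    have "s \<le> R (Suc n) z" "R (Suc n) z \<le> s + B * \<theta> ^ n"
      using low[of s n 1 z] up[of n "s + B * \<theta> ^ n" 1 z] s by simp_all
    with s[THEN spec, of z] show ?thesis by linarith
  qed
  then obtain q where q: "\<And>n. \<bar>R n z - q\<bar> \<le> B / (1 - \<theta>) * \<theta> ^ n"
    by (rule geometric_increments[OF \<theta>_bounds]) (rule that)
  have "(\<lambda>n. R n z) \<longlonglongrightarrow> q"
    by (rule tendsto_of_geometric_bound[OF \<theta>_bounds q])
  then have cq: "c \<le> q" using Rc by (intro LIMSEQ_le_const) auto
  have "\<bar>R n x - q\<bar> \<le> (B + B / (1 - \<theta>)) * \<theta> ^ n" for n x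
  proof -
    obtain s where s: "\<forall>x. s \<le> R n x \<and> R n x \<le> s + B * \<theta> ^ n" using osc[of n] by (elim exE)
    have "\<bar>R n x - R n z\<bar> \<le> B * \<theta> ^ n" using s[THEN spec, of x] s[THEN spec, of z] by linarith
    with q[of n] show ?thesis unfolding distrib_right by linarith
  qed
  with c cq Rc show thesis
    using B \<theta>_bounds by (intro that[of c "B + B / (1 - \<theta>)" q]) (auto simp: R_def)
qed

section \<open>The leading eigenvalue and its eigenfunction\<close>

text \<open>
  The growth rate of \<open>L ^^ n 1\<close> and leading eigenvalue of \<open>L\<close>. The base point is arbitrary: the ratios
  have the same limit everywhere.
\<close>

definition \<rho> :: real where
  "\<rho> = Topological_Spaces.lim (\<lambda>n. (L ^^ Suc n) (\<lambda>_. 1) (\<lambda>_. 0) / (L ^^ n) (\<lambda>_. 1) (\<lambda>_. 0))"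

lemma \<rho>_ratio:
  obtains B c where "0 < c" "0 \<le> B" "c \<le> \<rho>"
    "\<And>n x. c \<le> (L ^^ Suc n) one x / (L ^^ n) one x"
    "\<And>n x. \<bar>(L ^^ Suc n) one x / (L ^^ n) one x - \<rho>\<bar> \<le> B * \<theta> ^ n"
proof -
  have L1: "L one \<in> cone a" by (intro L_cone_a_a one_cone)
  have comm: "(L ^^ n) (L one) = (L ^^ Suc n) one" for n by (metis funpow_swap1 funpow.simps(2) o_apply)
  obtain q B c where *: "0 < c" "0 \<le> B" "c \<le> q"
    "\<And>n x. c \<le> (L ^^ Suc n) one x / (L ^^ n) one x"
    "\<And>n x. \<bar>(L ^^ Suc n) one x / (L ^^ n) one x - q\<bar> \<le> B * \<theta> ^ n"
    by (rule ratio_limit[OF L1 one_cone]) (unfold comm, rule that)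
  have "\<rho> = q" unfolding \<rho>_def
    by (rule limI, rule tendsto_of_geometric_bound[OF \<theta>_bounds *(5)])
  with * show thesis by (intro that[of c B]) auto
qed

lemma \<rho>_pos: "0 < \<rho>"
  by (rule \<rho>_ratio) linarith

definition h :: "seq \<Rightarrow> real" where
  "h x = Topological_Spaces.lim (\<lambda>n. (L ^^ n) one x / \<rho> ^ n)"

text \<open>
  The increments of \<open>ln (L ^^ n 1 / \<rho> ^ n)\<close> are the deviations of \<open>ln (L ^^ Suc n 1 / L ^^ n 1)\<close> from
  \<open>ln \<rho>\<close>, so they are summable. Taking logarithms gives the upper and the lower bound at once.
\<close>

lemma h_limit:
  obtains M C where "0 < M" "0 \<le> C"
    "\<And>n x. inverse M \<le> (L ^^ n) one x / \<rho> ^ n" "\<And>n x. (L ^^ n) one x / \<rho> ^ n \<le> M"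
    "\<And>x. inverse M \<le> h x" "\<And>x. h x \<le> M"
    "\<And>n x. \<bar>(L ^^ n) one x / \<rho> ^ n - h x\<bar> \<le> C * \<theta> ^ n"
proof -
  obtain B c where c: "0 < c" "c \<le> \<rho>" and B: "0 \<le> B"
    and R: "\<And>n x. c \<le> (L ^^ Suc n) one x / (L ^^ n) one x"
    "\<And>n x. \<bar>(L ^^ Suc n) one x / (L ^^ n) one x - \<rho>\<bar> \<le> B * \<theta> ^ n"
    by (rule \<rho>_ratio) (rule that)
  define v where "v n x = (L ^^ n) one x / \<rho> ^ n" for n x
  have vpos: "0 < v n x" for n x using Lpow_one_pos \<rho>_pos by (simp add: v_def)
  define D where "D = B / c / (1 - \<theta>)"
  have D: "0 \<le> D" using B c \<theta>_bounds by (simp add: D_def)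
  have "\<exists>w. \<forall>n. \<bar>ln (v n x) - w\<bar> \<le> D * \<theta> ^ n" for x
  proof -
    have "\<bar>ln (v (Suc n) x) - ln (v n x)\<bar> \<le> B / c * \<theta> ^ n" for n
    proof -
      have "ln (v (Suc n) x) - ln (v n x) = ln ((L ^^ Suc n) one x / (L ^^ n) one x) - ln \<rho>"
        using Lpow_one_pos[of "Suc n" x] Lpow_one_pos[of n x] \<rho>_pos
        by (simp add: v_def ln_div ln_mult del: funpow.simps)
      also have "\<bar>\<dots>\<bar> \<le> \<bar>(L ^^ Suc n) one x / (L ^^ n) one x - \<rho>\<bar> / c"
        by (rule abs_ln_diff_le[OF c(1) R(1) c(2)])
      also have "\<dots> \<le> B * \<theta> ^ n / c" using R(2)[of n x] c by (intro divide_right_mono) auto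
      finally show ?thesis by simp
    qed
    from geometric_increments[OF \<theta>_bounds this] show ?thesis unfolding D_def by blast
  qed
  then obtain w where w: "\<And>n x. \<bar>ln (v n x) - w x\<bar> \<le> D * \<theta> ^ n" by metis
  have wD: "\<bar>w x\<bar> \<le> D" for x using w[of 0 x] by (simp add: v_def)
  have vD: "\<bar>ln (v n x)\<bar> \<le> 2 * D" for n x
  proof -
    have "D * \<theta> ^ n \<le> D * 1"
      using D \<theta>_bounds by (intro mult_left_mono power_le_one) auto
    with w[of n x] wD[of x] show ?thesis by linarith
  qed
  have wD2: "\<bar>w x\<bar> \<le> 2 * D" for x using wD[of x] D by linarith
  have close: "\<bar>v n x - exp (w x)\<bar> \<le> exp (2 * D) * D * \<theta> ^ n" for n x
  proof -
    have "\<bar>v n x - exp (w x)\<bar> \<le> exp (2 * D) * \<bar>ln (v n x) - w x\<bar>"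
      using abs_exp_diff_le[OF vD wD2, of n x x] vpos by simp
    also have "\<dots> \<le> exp (2 * D) * (D * \<theta> ^ n)" by (intro mult_left_mono w) auto
    finally show ?thesis by (simp add: mult.assoc)
  qed
  have h: "h x = exp (w x)" for x
    unfolding h_def v_def[symmetric]
    by (rule limI, rule tendsto_of_geometric_bound[OF \<theta>_bounds close])
  have lo: "inverse (exp (2 * D)) \<le> v n x" and hi: "v n x \<le> exp (2 * D)" for n x
  proof -
    have "v n x = exp (ln (v n x))" using vpos by simp
    moreover have "exp (- (2 * D)) \<le> exp (ln (v n x))" "exp (ln (v n x)) \<le> exp (2 * D)"
      using vD[of n x] unfolding exp_le_cancel_iff by linarith+
    ultimately show "inverse (exp (2 * D)) \<le> v n x" "v n x \<le> exp (2 * D)"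
      by (simp_all add: exp_minus)
  qed
  have lo': "inverse (exp (2 * D)) \<le> h x" and hi': "h x \<le> exp (2 * D)" for x
    unfolding h using wD2[of x] by (auto simp flip: exp_minus)
  show thesis
    by (rule that[of "exp (2 * D)" "exp (2 * D) * D"])
      (use D lo hi lo' hi' close in \<open>auto simp: h v_def\<close>)
qed

lemma h_pos: "0 < h x"
proof (rule h_limit)
  fix M C assume "0 < M" "\<And>x. inverse M \<le> h x"
  then show ?thesis using less_le_trans positive_imp_inverse_positive by blast
qed

lemma h_LIMSEQ: "(\<lambda>n. (L ^^ n) one x / \<rho> ^ n) \<longlonglongrightarrow> h x"
  by (rule h_limit) (rule tendsto_of_geometric_bound[OF \<theta>_bounds])

lemma h_cone: "h \<in> cone a"
proof -
  have "h x \<le> exp (a * r ^ m) * h y" if "agree m x y" for m x y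
  proof (rule LIMSEQ_le[OF h_LIMSEQ tendsto_mult_left[OF h_LIMSEQ]], intro exI allI impI)
    fix n
    have "(L ^^ n) one x \<le> exp (a * r ^ m) * (L ^^ n) one y"
      by (rule coneD(2)[OF Lpow_cone[OF one_cone] that])
    then show "(L ^^ n) one x / \<rho> ^ n \<le> exp (a * r ^ m) * ((L ^^ n) one y / \<rho> ^ n)"
      using \<rho>_pos by (simp add: divide_right_mono)
  qed
  with h_pos show ?thesis by (simp add: cone_def)
qed

text \<open>
  The eigenfunction equation passes to the limit because \<open>L\<close> is continuous for uniform convergence.
\<close>

lemma L_h: "L h x = \<rho> * h x"
proof -
  obtain M C where C: "\<And>n x. \<bar>(L ^^ n) one x / \<rho> ^ n - h x\<bar> \<le> C * \<theta> ^ n"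
    by (rule h_limit) (rule that)
  have "\<bar>\<rho> * ((L ^^ Suc n) one x / \<rho> ^ Suc n) - L h x\<bar> \<le> (S * C) * \<theta> ^ n" for n
  proof -
    have "L (\<lambda>y. inverse (\<rho> ^ n) * (L ^^ n) one y) x = \<rho> * ((L ^^ Suc n) one x / \<rho> ^ Suc n)"
      unfolding L_scale using \<rho>_pos by (simp add: field_simps)
    moreover have "\<bar>inverse (\<rho> ^ n) * (L ^^ n) one y\<bar> \<le> inverse (\<rho> ^ n) * (exp a * (L ^^ n) one (\<lambda>_. 0))" for y
      using cone_bound[OF Lpow_cone[OF one_cone], of n y] \<rho>_pos
      unfolding abs_mult by (intro mult_mono) auto
    then have "\<bar>L (\<lambda>y. inverse (\<rho> ^ n) * (L ^^ n) one y) x - L h x\<bar> \<le> S * (C * \<theta> ^ n)"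
      by (rule L_diff_le[OF _ cone_bound[OF h_cone]]) (use C[of n] in \<open>simp add: field_simps\<close>)
    ultimately show ?thesis by (simp add: mult.assoc)
  qed
  then have "(\<lambda>n. \<rho> * ((L ^^ Suc n) one x / \<rho> ^ Suc n)) \<longlonglongrightarrow> L h x"
    by (rule tendsto_of_geometric_bound[OF \<theta>_bounds])
  moreover have "(\<lambda>n. \<rho> * ((L ^^ Suc n) one x / \<rho> ^ Suc n)) \<longlonglongrightarrow> \<rho> * h x"
    by (intro tendsto_mult_left LIMSEQ_Suc[OF h_LIMSEQ])
  ultimately show ?thesis by (rule LIMSEQ_unique)
qed

section \<open>Exponential convergence for Hoelder functions\<close>

text \<open>
  Since \<open>m = 0\<close> is included, these functions are also bounded.
\<close>

definition hoelder :: "(seq \<Rightarrow> real) \<Rightarrow> bool" where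
  "hoelder f \<longleftrightarrow> (\<exists>V. \<forall>m x y. agree m x y \<longrightarrow> \<bar>f x - f y\<bar> \<le> V * r ^ m)"

lemma hoelder_bounded:
  assumes "hoelder f"
  obtains B where "\<And>x. \<bar>f x\<bar> \<le> B"
proof -
  obtain V where V: "\<forall>m x y. agree m x y \<longrightarrow> \<bar>f x - f y\<bar> \<le> V * r ^ m" using assms hoelder_def by blast
  have "\<bar>f x\<bar> \<le> V + \<bar>f (\<lambda>_. 0)\<bar>" for x
    using V[THEN spec, of 0, THEN spec, of x, THEN spec, of "\<lambda>_. 0"] by simp
  then show thesis by (rule that)
qed

lemma hoelder_const: "hoelder (\<lambda>_. c)"
  unfolding hoelder_def by (intro exI[of _ 0]) auto

lemma hoelder_add:
  assumes "hoelder f" "hoelder g"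
  shows "hoelder (\<lambda>x. f x + g x)"
proof -
  obtain V where V: "\<forall>m x y. agree m x y \<longrightarrow> \<bar>f x - f y\<bar> \<le> V * r ^ m" using assms hoelder_def by blast
  obtain W where W: "\<forall>m x y. agree m x y \<longrightarrow> \<bar>g x - g y\<bar> \<le> W * r ^ m" using assms hoelder_def by blast
  show ?thesis unfolding hoelder_def
  proof (intro exI allI impI)
    fix m x y assume "agree m x y"
    with V W have "\<bar>f x - f y\<bar> \<le> V * r ^ m" "\<bar>g x - g y\<bar> \<le> W * r ^ m" by auto
    then show "\<bar>f x + g x - (f y + g y)\<bar> \<le> (V + W) * r ^ m" unfolding distrib_right by linarith
  qed
qed

lemma hoelder_scale:
  assumes "hoelder f"
  shows "hoelder (\<lambda>x. c * f x)"
proof -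
  obtain V where V: "\<forall>m x y. agree m x y \<longrightarrow> \<bar>f x - f y\<bar> \<le> V * r ^ m" using assms hoelder_def by blast
  show ?thesis unfolding hoelder_def
  proof (intro exI allI impI)
    fix m x y assume "agree m x y"
    with V have "\<bar>f x - f y\<bar> \<le> V * r ^ m" by auto
    then have "\<bar>c\<bar> * \<bar>f x - f y\<bar> \<le> \<bar>c\<bar> * (V * r ^ m)" by (intro mult_left_mono) auto
    then show "\<bar>c * f x - c * f y\<bar> \<le> (\<bar>c\<bar> * V) * r ^ m"
      by (simp add: abs_mult mult.assoc flip: right_diff_distrib)
  qed
qed

lemma hoelder_uniformly_continuous:
  assumes "hoelder f" "0 < e"
  shows "\<exists>m. \<forall>x y. agree m x y \<longrightarrow> \<bar>f x - f y\<bar> < e"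
proof -
  obtain V where V: "\<forall>m x y. agree m x y \<longrightarrow> \<bar>f x - f y\<bar> \<le> V * r ^ m" using assms hoelder_def by blast
  have "(\<lambda>m. V * r ^ m) \<longlonglongrightarrow> V * 0"
    using r_pos r_less_1 by (intro tendsto_mult_left LIMSEQ_realpow_zero) auto
  then have "\<forall>\<^sub>F m in sequentially. V * r ^ m < e" using assms(2) by (intro order_tendstoD) auto
  then obtain m where "V * r ^ m < e" by (auto simp: eventually_sequentially)
  with V show ?thesis by (meson le_less_trans)
qed

lemma hoelder_measurable: "hoelder f \<Longrightarrow> f \<in> borel_measurable borel"
  by (rule uniformly_continuous_measurable) (rule hoelder_uniformly_continuous)

lemma depends_hoelder:
  assumes "depends m f" "\<And>x. \<bar>f x\<bar> \<le> B"
  shows "hoelder f"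
proof -
  have B: "0 \<le> B" using assms(2)[of "\<lambda>_. 0"] by simp
  have "\<bar>f x - f y\<bar> \<le> 2 * B / r ^ m * r ^ k" if "agree k x y" for k x y
  proof (cases "m \<le> k")
    case True
    then have "agree m x y" using that by (auto simp: agree_def)
    then have "f x = f y" using assms(1) by (rule dependsD[rotated])
    then show ?thesis using B r_pos by simp
  next
    case False
    then have "r ^ m \<le> r ^ k" using r_pos r_less_1 by (intro power_decreasing) auto
    then have "2 * B * 1 \<le> 2 * B * (r ^ k / r ^ m)" using B r_pos by (intro mult_left_mono) auto
    moreover have "\<bar>f x - f y\<bar> \<le> 2 * B" using assms(2)[of x] assms(2)[of y] by linarith
    ultimately show ?thesis by simp
  qed
  then show ?thesis unfolding hoelder_def by (intro exI[of _ "2 * B / r ^ m"] allI impI)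
qed

lemma hoelder_indicator: "depends m (\<lambda>x. x \<in> E) \<Longrightarrow> hoelder (indicat_real E)"
  by (rule depends_hoelder[OF depends_indicator, of m E 1]) (auto simp: indicator_def)

lemma cone_hoelder:
  assumes "f \<in> cone b" "0 \<le> b"
  shows "hoelder f"
proof -
  define B where "B = exp b * f (\<lambda>_. 0)"
  have B: "f x \<le> B" for x unfolding B_def by (rule cone_le[OF assms(1)])
  have *: "f x - f y \<le> B * (exp b * b) * r ^ m" if "agree m x y" for m x y
  proof -
    have "f x - f y \<le> f y * (exp (b * r ^ m) - 1)"
      using coneD(2)[OF assms(1) that] by (simp add: algebra_simps)
    also have "exp (b * r ^ m) - 1 \<le> exp b * (b * r ^ m)"
    proof -
      have "\<bar>exp (b * r ^ m) - exp 0\<bar> \<le> exp b * \<bar>b * r ^ m - 0\<bar>"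
        using assms(2) r_pos r_power_le_1[of m] by (intro abs_exp_diff_le) (auto simp: abs_mult mult_left_le)
      then show ?thesis using assms(2) r_pos by (simp add: abs_mult)
    qed
    then have "f y * (exp (b * r ^ m) - 1) \<le> B * (exp b * (b * r ^ m))"
      using B[of y] B[of x] coneD(1)[OF assms(1), of y] assms(2) r_pos
      by (intro mult_mono) auto
    finally show ?thesis by (simp add: mult_ac)
  qed
  show ?thesis unfolding hoelder_def
  proof (intro exI allI impI)
    fix m x y assume "agree m x y"
    from *[OF this] *[OF agree_sym[OF this]] show "\<bar>f x - f y\<bar> \<le> B * (exp b * b) * r ^ m" by simp
  qed
qed

text \<open>
  Adding a large constant makes a Hoelder function nearly constant in the logarithmic sense. Linear
  statements about Hoelder functions thereby reduce to the cone.
\<close>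

lemma hoelder_shift_cone:
  assumes "hoelder f"
  obtains b where "(\<lambda>x. f x + b) \<in> cone a"
proof -
  obtain V where V: "\<forall>m x y. agree m x y \<longrightarrow> \<bar>f x - f y\<bar> \<le> V * r ^ m"
    using assms hoelder_def by blast
  obtain B where B: "\<And>x. \<bar>f x\<bar> \<le> B" by (rule hoelder_bounded[OF assms]) (rule that)
  have V0: "0 \<le> V" using V[THEN spec, of 0] by (fastforce simp: agree_def intro: order_trans[OF abs_ge_zero])
  \<comment> \<open>With this constant \<open>f + b \<ge> V / a + 1\<close>, so that \<open>V r ^ m \<le> (f + b) a r ^ m\<close>.\<close>
  define b where "b = B + V / a + 1"
  have pos: "V / a + 1 \<le> f x + b" for x using B[of x] by (simp add: b_def)
  have "f x + b \<le> exp (a * r ^ m) * (f y + b)" if "agree m x y" for m x y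
  proof -
    have "f x + b \<le> f y + b + V * r ^ m" using V that by (smt (verit, best))
    also have "V * r ^ m \<le> (f y + b) * (a * r ^ m)"
    proof -
      have "V \<le> (f y + b) * a" using pos[of y] a_pos by (simp add: field_simps)
      then have "V * r ^ m \<le> (f y + b) * a * r ^ m" using r_pos by (intro mult_right_mono) auto
      then show ?thesis by (simp add: mult.assoc)
    qed
    then have "f y + b + V * r ^ m \<le> (1 + a * r ^ m) * (f y + b)" by (simp add: algebra_simps)
    also have "\<dots> \<le> exp (a * r ^ m) * (f y + b)"
      using pos[of y] V0 a_pos exp_ge_add_one_self[of "a * r ^ m"]
      by (intro mult_right_mono) (auto intro: order_trans[rotated])
    finally show ?thesis .
  qed
  moreover have "0 < f x + b" for x using pos[of x] V0 a_pos
    by (smt (verit) divide_nonneg_pos)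
  ultimately have "(\<lambda>x. f x + b) \<in> cone a" by (simp add: cone_def)
  then show thesis by (rule that)
qed

lemma hoelder_L:
  assumes "hoelder g"
  shows "hoelder (L g)"
proof -
  obtain b where b: "(\<lambda>x. g x + b) \<in> cone a" by (rule hoelder_shift_cone[OF assms])
  obtain B where gB: "\<And>x. \<bar>g x\<bar> \<le> B" by (rule hoelder_bounded[OF assms]) (rule that)
  have bB: "\<bar>b * one x\<bar> \<le> \<bar>b\<bar>" for x by simp
  have "L g x = L (\<lambda>x. g x + b) x + (- b) * L one x" for x
  proof -
    have "L (\<lambda>x. g x + b * one x) x = L g x + L (\<lambda>x. b * one x) x"
      by (rule L_add[OF gB bB])
    then show ?thesis unfolding L_scale by simp
  qed
  then have "L g = (\<lambda>x. L (\<lambda>x. g x + b) x + (- b) * L one x)" by blast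
  moreover have "hoelder (L f)" if "f \<in> cone a" for f
    using cone_hoelder[OF L_cone_a_a[OF that]] a_pos by simp
  ultimately show ?thesis
    by (simp only:) (intro hoelder_add hoelder_scale; use b one_cone in blast)
qed

lemma hoelder_Lpow: "hoelder g \<Longrightarrow> hoelder ((L ^^ n) g)"
  by (induction n) (auto intro: hoelder_L)

text \<open>
  With \<open>g + b\<close> in the cone, \<open>L ^^ n (g + b)\<close> is compared with \<open>L ^^ n 1\<close> by the ratio limit, and
  \<open>L ^^ n 1 / \<rho> ^ n\<close> with \<open>h\<close>.
\<close>

lemma hoelder_conv:
  assumes "hoelder g"
  obtains q C where "\<And>n x. \<bar>(L ^^ n) g x / \<rho> ^ n - q * h x\<bar> \<le> C * \<theta> ^ n"
proof -
  obtain M C1 where M: "0 < M" "0 \<le> C1" "\<And>n x. (L ^^ n) one x / \<rho> ^ n \<le> M" 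
    and C1: "\<And>n x. \<bar>(L ^^ n) one x / \<rho> ^ n - h x\<bar> \<le> C1 * \<theta> ^ n"
    by (rule h_limit) (rule that)
  obtain b where b: "(\<lambda>x. g x + b) \<in> cone a" by (rule hoelder_shift_cone[OF assms])
  obtain B where gB: "\<And>x. \<bar>g x\<bar> \<le> B" by (rule hoelder_bounded[OF assms]) (rule that)
  have bB: "\<bar>b * one x\<bar> \<le> \<bar>b\<bar>" for x by simp
  obtain q B c where q: "0 < c" "0 \<le> B" "c \<le> q"
    "\<And>n x. c \<le> (L ^^ n) (\<lambda>x. g x + b) x / (L ^^ n) one x"
    "\<And>n x. \<bar>(L ^^ n) (\<lambda>x. g x + b) x / (L ^^ n) one x - q\<bar> \<le> B * \<theta> ^ n"
    by (rule ratio_limit[OF b one_cone]) (rule that)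
  have "\<bar>(L ^^ n) g x / \<rho> ^ n - (q - b) * h x\<bar> \<le> (B * M + (\<bar>q\<bar> + \<bar>b\<bar>) * C1) * \<theta> ^ n" for n x
  proof -
    define v where "v = (L ^^ n) one x / \<rho> ^ n"
    define R where "R = (L ^^ n) (\<lambda>x. g x + b) x / (L ^^ n) one x"
    have v: "0 < v" using Lpow_one_pos \<rho>_pos by (simp add: v_def)
    have "(L ^^ n) (\<lambda>x. g x + b * one x) x = (L ^^ n) g x + (L ^^ n) (\<lambda>x. b * one x) x"
      by (rule Lpow_add[OF gB bB])
    then have "(L ^^ n) (\<lambda>x. g x + b) x = (L ^^ n) g x + b * (L ^^ n) one x"
      unfolding Lpow_scale by simp
    then have "(L ^^ n) g x / \<rho> ^ n = (R - b) * v"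
      using Lpow_one_pos[of n x] by (simp add: R_def v_def field_simps)
    then have "(L ^^ n) g x / \<rho> ^ n - (q - b) * h x = (R - q) * v + (q - b) * (v - h x)"
      by (simp add: algebra_simps)
    also have "\<bar>\<dots>\<bar> \<le> \<bar>R - q\<bar> * v + \<bar>q - b\<bar> * \<bar>v - h x\<bar>"
      using v abs_triangle_ineq[of "(R - q) * v" "(q - b) * (v - h x)"] by (simp add: abs_mult)
    also have "\<dots> \<le> (B * \<theta> ^ n) * M + (\<bar>q\<bar> + \<bar>b\<bar>) * (C1 * \<theta> ^ n)"
      using q(5)[of n x] q(2) C1[of n x] M(3)[of n x] v \<theta>_bounds
      by (intro add_mono mult_mono) (auto simp: R_def v_def)
    finally show ?thesis by (simp add: algebra_simps)
  qed
  then show thesis by (rule that)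
qed

text \<open>
  The positive linear functional that will be integration against the eigenmeasure. Being defined as
  a limit, it is linear and monotone on Hoelder functions, and it scales by \<open>\<rho>\<close> under \<open>L\<close>.
\<close>

definition ell :: "(seq \<Rightarrow> real) \<Rightarrow> real" where
  "ell g = Topological_Spaces.lim (\<lambda>n. (L ^^ n) g (\<lambda>_. 0) / \<rho> ^ n / h (\<lambda>_. 0))"

lemma ell_eqI:
  assumes "(\<lambda>n. (L ^^ n) g (\<lambda>_. 0) / \<rho> ^ n) \<longlonglongrightarrow> q * h (\<lambda>_. 0)"
  shows "ell g = q"
proof -
  have "(\<lambda>n. (L ^^ n) g (\<lambda>_. 0) / \<rho> ^ n / h (\<lambda>_. 0)) \<longlonglongrightarrow> q * h (\<lambda>_. 0) / h (\<lambda>_. 0)"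
    using h_pos[of "\<lambda>_. 0"] by (intro tendsto_divide assms tendsto_const) auto
  then show ?thesis unfolding ell_def using h_pos[of "\<lambda>_. 0"] by (intro limI) simp
qed

lemma ell_rate:
  assumes "hoelder g"
  obtains C where "\<And>n x. \<bar>(L ^^ n) g x / \<rho> ^ n - ell g * h x\<bar> \<le> C * \<theta> ^ n"
proof -
  obtain q C where q: "\<And>n x. \<bar>(L ^^ n) g x / \<rho> ^ n - q * h x\<bar> \<le> C * \<theta> ^ n"
    by (rule hoelder_conv[OF assms]) (rule that)
  have "ell g = q"
    by (rule ell_eqI, rule tendsto_of_geometric_bound[OF \<theta>_bounds q])
  with q show thesis by (intro that[of C]) simp
qed

lemma ell_LIMSEQ:
  assumes "hoelder g"
  shows "(\<lambda>n. (L ^^ n) g x / \<rho> ^ n) \<longlonglongrightarrow> ell g * h x"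
  by (rule ell_rate[OF assms]) (rule tendsto_of_geometric_bound[OF \<theta>_bounds])

lemma ell_add:
  assumes f: "hoelder f" and g: "hoelder g"
  shows "ell (\<lambda>x. f x + g x) = ell f + ell g"
proof (rule ell_eqI)
  obtain B where B: "\<And>x. \<bar>f x\<bar> \<le> B" by (rule hoelder_bounded[OF f]) (rule that)
  obtain B' where B': "\<And>x. \<bar>g x\<bar> \<le> B'" by (rule hoelder_bounded[OF g]) (rule that)
  show "(\<lambda>n. (L ^^ n) (\<lambda>x. f x + g x) (\<lambda>_. 0) / \<rho> ^ n) \<longlonglongrightarrow> (ell f + ell g) * h (\<lambda>_. 0)"
    unfolding Lpow_add[OF B B'] add_divide_distrib distrib_right
    by (intro tendsto_add ell_LIMSEQ f g)
qed

lemma ell_scale: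
  assumes g: "hoelder g"
  shows "ell (\<lambda>x. c * g x) = c * ell g"
proof (rule ell_eqI)
  show "(\<lambda>n. (L ^^ n) (\<lambda>x. c * g x) (\<lambda>_. 0) / \<rho> ^ n) \<longlonglongrightarrow> c * ell g * h (\<lambda>_. 0)"
    unfolding Lpow_scale mult.assoc times_divide_eq_right[symmetric]
    by (intro tendsto_mult_left ell_LIMSEQ g)
qed

lemma ell_one: "ell one = 1"
  by (rule ell_eqI) (use h_LIMSEQ in simp)

lemma ell_const: "ell (\<lambda>_. c) = c"
  using ell_scale[OF hoelder_const[of 1], of c] ell_one by simp

lemma ell_sum:
  assumes "finite F" "\<And>j. j \<in> F \<Longrightarrow> hoelder (f j)"
  shows "hoelder (\<lambda>x. \<Sum>j\<in>F. f j x) \<and> ell (\<lambda>x. \<Sum>j\<in>F. f j x) = (\<Sum>j\<in>F. ell (f j))"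
  using assms
proof (induction F rule: finite_induct)
  case empty
  then show ?case by (simp add: hoelder_const ell_const)
next
  case (insert j F)
  then show ?case by (simp add: hoelder_add ell_add)
qed

lemma ell_mono:
  assumes f: "hoelder f" and g: "hoelder g" and le: "\<And>x. f x \<le> g x"
  shows "ell f \<le> ell g"
proof -
  obtain B where B: "\<And>x. \<bar>f x\<bar> \<le> B" by (rule hoelder_bounded[OF f]) (rule that)
  obtain B' where B': "\<And>x. \<bar>g x\<bar> \<le> B'" by (rule hoelder_bounded[OF g]) (rule that)
  have "ell f * h (\<lambda>_. 0) \<le> ell g * h (\<lambda>_. 0)"
    using Lpow_mono[OF B B' le] \<rho>_pos
    by (intro LIMSEQ_le[OF ell_LIMSEQ[OF f] ell_LIMSEQ[OF g]]) (auto intro!: divide_right_mono)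
  then show ?thesis using h_pos[of "\<lambda>_. 0"] by simp
qed

lemma ell_indicator_nonneg: "depends m (\<lambda>x. x \<in> E) \<Longrightarrow> 0 \<le> ell (indicat_real E)"
  using ell_mono[OF hoelder_const hoelder_indicator, of m E 0] by (simp add: ell_const)

lemma ell_L:
  assumes g: "hoelder g"
  shows "ell (L g) = \<rho> * ell g"
proof (rule ell_eqI)
  have "(L ^^ n) (L g) = (L ^^ Suc n) g" for n by (metis funpow_swap1 funpow.simps(2) o_apply)
  then have "(\<lambda>n. (L ^^ n) (L g) (\<lambda>_. 0) / \<rho> ^ n) = (\<lambda>n. \<rho> * ((L ^^ Suc n) g (\<lambda>_. 0) / \<rho> ^ Suc n))"
    using \<rho>_pos by (simp add: fun_eq_iff)
  then show "(\<lambda>n. (L ^^ n) (L g) (\<lambda>_. 0) / \<rho> ^ n) \<longlonglongrightarrow> \<rho> * ell g * h (\<lambda>_. 0)"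
    unfolding mult.assoc by (simp only:) (intro tendsto_mult_left LIMSEQ_Suc[OF ell_LIMSEQ[OF g]])
qed

lemma ell_Lpow: "hoelder g \<Longrightarrow> ell ((L ^^ n) g) = \<rho> ^ n * ell g"
  by (induction n) (auto simp: ell_L hoelder_Lpow)

section \<open>Pressure and periodic points\<close>

definition weight :: "nat list \<Rightarrow> seq \<Rightarrow> real" where
  "weight w x = exp (birkhoff_sum \<phi> (length w) (prepend w x))"

lemma weight_Nil [simp]: "weight [] x = 1"
  by (simp add: weight_def birkhoff_sum_def)

lemma weight_Cons: "weight (i # w) x = exp (\<phi> (case_nat i (prepend w x))) * weight w x"
  by (simp add: weight_def birkhoff_sum_Suc_case_nat exp_add)

lemma weight_pos: "0 < weight w x"
  by (simp add: weight_def)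

text \<open>
  Multiplicativity makes this majorant of the weights summable over words of a given length.
\<close>

definition word_bound :: "nat list \<Rightarrow> real" where
  "word_bound w = prod_list (map letter_bound w)"

lemma word_bound_nonneg: "0 \<le> word_bound w"
  unfolding word_bound_def using letter_bound_pos
  by (induction w) (auto intro!: mult_nonneg_nonneg simp: less_imp_le)

lemma weight_le_word_bound: "weight w x \<le> word_bound w"
proof (induction w)
  case (Cons i w)
  have "weight (i # w) x \<le> letter_bound i * word_bound w"
    unfolding weight_Cons using letter_bound_pos[of i] weight_pos[of w x]
    by (intro mult_mono exp_le_letter_bound Cons) auto
  then show ?case by (simp add: word_bound_def)
qed (simp add: word_bound_def)

lemma summable_word_bound: "word_bound summable_on words n"
proof (induction n)
  case (Suc n)
  have "(\<lambda>(w, i). word_bound w * letter_bound i) summable_on (words n \<times> UNIV)"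
    by (rule summable_on_SigmaI[where g = "\<lambda>w. word_bound w * S"])
      (use word_bound_nonneg letter_bound_pos in \<open>auto simp: S_def less_imp_le
        intro!: has_sum_cmult_right has_sum_infsum summable_letter_bound summable_on_cmult_left Suc\<close>)
  then have "(word_bound \<circ> (\<lambda>(w, i). i # w)) summable_on (words n \<times> UNIV)"
    by (simp add: word_bound_def case_prod_unfold o_def mult.commute)
  then show ?case by (simp add: words_Suc summable_on_reindex[OF inj_Cons])
qed (simp add: words_0)

lemma summable_weight:
  assumes "\<And>x. \<bar>f x\<bar> \<le> B"
  shows "(\<lambda>w. weight w x * f (prepend w x)) summable_on words n"
proof (rule summable_on_real_dominated)
  show "(\<lambda>w. word_bound w * B) summable_on words n"
    by (intro summable_on_cmult_left summable_word_bound)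
  show "\<bar>weight w x * f (prepend w x)\<bar> \<le> word_bound w * B" for w
    using weight_le_word_bound[of w x] weight_pos[of w x] assms word_bound_nonneg
    by (auto simp: abs_mult intro!: mult_mono)
qed

text \<open>
  Induction on \<open>n\<close>, with \<open>L f\<close> in place of \<open>f\<close>: the new letter is then put in front of the word, which
  matches the recursion of the weights.
\<close>

lemma Lpow_words:
  assumes "\<And>x. \<bar>f x\<bar> \<le> B"
  shows "(L ^^ n) f x = (\<Sum>\<^sub>\<infinity>w\<in>words n. weight w x * f (prepend w x))"
  using assms
proof (induction n arbitrary: f B)
  case 0
  then show ?case by (simp add: words_0)
next
  case (Suc n)
  let ?F = "\<lambda>w. weight w x * f (prepend w x)"
  have "(L ^^ Suc n) f x = (L ^^ n) (L f) x" by (metis funpow_swap1 funpow.simps(2) o_apply)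
  also have "\<dots> = (\<Sum>\<^sub>\<infinity>w\<in>words n. weight w x * L f (prepend w x))"
    by (rule Suc.IH[OF L_bound[OF Suc.prems]])
  also have "\<dots> = (\<Sum>\<^sub>\<infinity>w\<in>words n. \<Sum>\<^sub>\<infinity>i. ?F (i # w))"
    unfolding transfer_op_alt
    by (intro infsum_cong, subst infsum_cmult_right'[symmetric]) (simp add: weight_Cons mult_ac)
  also have "\<dots> = (\<Sum>\<^sub>\<infinity>(w, i)\<in>words n \<times> UNIV. ?F (i # w))"
  proof (rule infsum_Sigma'_banach)
    have "?F summable_on (\<lambda>(w, i). i # w) ` (words n \<times> UNIV)"
      unfolding words_Suc[symmetric] by (rule summable_weight[OF Suc.prems])
    then show "(\<lambda>(w, i). ?F (i # w)) summable_on (words n \<times> UNIV)"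
      by (subst (asm) summable_on_reindex[OF inj_Cons]) (simp add: o_def case_prod_unfold)
  qed
  also have "\<dots> = infsum ?F (words (Suc n))"
    unfolding words_Suc by (subst infsum_reindex[OF inj_Cons]) (simp add: o_def case_prod_unfold)
  finally show ?case .
qed

definition D :: real where "D = K / (1 - r)"

lemma D_nonneg: "0 \<le> D"
  using K_nonneg r_less_1 by (simp add: D_def)

text \<open>
  Bounded distortion: at time \<open>j\<close> the two orbits agree in \<open>n - j\<close> coordinates, so the differences are
  dominated by a geometric series.
\<close>

lemma birkhoff_distortion:
  "birkhoff_sum \<phi> (length w) (prepend w x) - birkhoff_sum \<phi> (length w) (prepend w y) \<le> D"
proof -
  have "birkhoff_sum \<phi> (length w) (prepend w x) - birkhoff_sum \<phi> (length w) (prepend w y)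
      \<le> K * (1 - r ^ length w) / (1 - r)"
  proof (induction w)
    case (Cons i w)
    have "\<phi> (case_nat i (prepend w x)) - \<phi> (case_nat i (prepend w y)) \<le> K * r ^ Suc (length w)"
      using holder[OF _ agree_case_nat[OF agree_prepend, of w i x y]] by linarith
    moreover have "K * r ^ Suc (length w) \<le> K * r ^ length w"
      using K_nonneg r_pos r_less_1 by (intro mult_left_mono power_decreasing) auto
    moreover have "K * r ^ length w + K * (1 - r ^ length w) / (1 - r) = K * (1 - r ^ length (i # w)) / (1 - r)"
      using r_less_1 by (simp add: field_simps)
    ultimately show ?case using Cons
      unfolding prepend_simps length_Cons birkhoff_sum_Suc_case_nat by linarith
  qed (simp add: birkhoff_sum_def)
  also have "\<dots> \<le> D"
    unfolding D_def using K_nonneg r_pos r_less_1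
    by (intro divide_right_mono) (auto simp: mult_left_le)
  finally show ?thesis .
qed

lemma weight_distortion: "weight w x \<le> exp D * weight w y"
  using birkhoff_distortion[of w x y] by (simp add: weight_def mult_exp_exp)

text \<open>
  Each supremum over a cylinder is comparable with the weight at any point of it.
\<close>

lemma partition_sum_bounds:
  "(L ^^ n) one x \<le> partition_sum \<phi> n" "partition_sum \<phi> n \<le> exp D * (L ^^ n) one x"
proof -
  define U where "U w = (SUP \<tau>\<in>cylinder w. exp (birkhoff_sum \<phi> n \<tau>))" for w
  have U: "weight w x \<le> U w" "U w \<le> exp D * weight w x" if "w \<in> words n" for w
  proof -
    have n: "length w = n" using that by (simp add: words_def)
    have eq: "(\<lambda>\<tau>. exp (birkhoff_sum \<phi> n \<tau>)) ` cylinder w = range (weight w)"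
      by (auto simp: cylinder_eq weight_def n)
    show "weight w x \<le> U w"
      unfolding U_def eq using weight_le_word_bound by (intro cSup_upper bdd_aboveI2) auto
    show "U w \<le> exp D * weight w x"
      unfolding U_def eq using weight_distortion by (intro cSup_least) auto
  qed
  have P: "partition_sum \<phi> n = infsum U (words n)"
    by (simp add: partition_sum_def U_def[abs_def] words_def)
  have ws: "(\<lambda>w. weight w x) summable_on words n"
    using summable_weight[of one 1 x n] by simp
  then have ews: "(\<lambda>w. exp D * weight w x) summable_on words n"
    by (rule summable_on_cmult_right)
  have Us: "U summable_on words n"
    by (rule summable_on_real_dominated[OF ews])
      (metis U abs_of_nonneg less_imp_le order_trans weight_pos)
  have Lw: "(L ^^ n) one x = (\<Sum>\<^sub>\<infinity>w\<in>words n. weight w x)"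
    using Lpow_words[of one 1 n x] by simp
  show "(L ^^ n) one x \<le> partition_sum \<phi> n"
    unfolding P Lw by (intro infsum_mono ws Us U)
  have "infsum U (words n) \<le> (\<Sum>\<^sub>\<infinity>w\<in>words n. exp D * weight w x)"
    by (intro infsum_mono Us ews U)
  then show "partition_sum \<phi> n \<le> exp D * (L ^^ n) one x"
    unfolding P Lw infsum_cmult_right' .
qed

text \<open>
  The partition sums are within a constant factor of \<open>L ^^ n 1\<close>, hence of \<open>\<rho> ^ n\<close>. Existence of
  the limit that defines the pressure is part of the conclusion.
\<close>

lemma pressure_eq: "pressure \<phi> = ln \<rho>"
proof -
  obtain M where M: "0 < M" "\<And>n x. inverse M \<le> (L ^^ n) one x / \<rho> ^ n"
    "\<And>n x. (L ^^ n) one x / \<rho> ^ n \<le> M"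
    by (rule h_limit) (rule that)
  have bound: "\<bar>ln (partition_sum \<phi> n) - real n * ln \<rho>\<bar> \<le> \<bar>ln M\<bar> + D" for n
  proof -
    define v where "v = (L ^^ n) one (\<lambda>_. 0)"
    have v: "0 < v" "v \<le> partition_sum \<phi> n" "partition_sum \<phi> n \<le> exp D * v"
      unfolding v_def by (rule Lpow_one_pos partition_sum_bounds)+
    have lnv: "ln v - real n * ln \<rho> = ln (v / \<rho> ^ n)"
      using v \<rho>_pos by (simp add: ln_div ln_realpow)
    have "ln (inverse M) \<le> ln (v / \<rho> ^ n)" "ln (v / \<rho> ^ n) \<le> ln M"
      using M(2,3)[of n "\<lambda>_. 0"] M(1) v(1) \<rho>_pos by (auto simp: v_def)
    then have "\<bar>ln v - real n * ln \<rho>\<bar> \<le> \<bar>ln M\<bar>" unfolding lnv using M(1) by (simp add: ln_inverse)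
    moreover have "ln v \<le> ln (partition_sum \<phi> n)" using v by simp
    moreover have "ln (partition_sum \<phi> n) \<le> ln (exp D * v)" using v by simp
    then have "ln (partition_sum \<phi> n) \<le> D + ln v" using v by (simp add: ln_mult)
    ultimately show ?thesis using D_nonneg by linarith
  qed
  have "(\<lambda>n. 1 / real n * ln (partition_sum \<phi> n) - ln \<rho>) \<longlonglongrightarrow> 0"
  proof (rule Lim_null_comparison)
    show "\<forall>\<^sub>F n in sequentially. norm (1 / real n * ln (partition_sum \<phi> n) - ln \<rho>) \<le> (\<bar>ln M\<bar> + D) / real n"
      using eventually_gt_at_top[of 0]
    proof eventually_elim
      case (elim n)
      then have "1 / real n * ln (partition_sum \<phi> n) - ln \<rho> = (ln (partition_sum \<phi> n) - real n * ln \<rho>) / real n"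
        by (simp add: field_simps)
      then show ?case using bound[of n] elim by (simp add: divide_right_mono)
    qed
    show "(\<lambda>n. (\<bar>ln M\<bar> + D) / real n) \<longlonglongrightarrow> 0" by (rule lim_const_over_n)
  qed
  then show ?thesis unfolding pressure_def by (intro limI) (simp add: LIM_zero_iff)
qed

text \<open>
  Points of period \<open>m + 1\<close> starting with \<open>i\<close> correspond to words \<open>v\<close> of length \<open>m\<close>, by repeating \<open>i v\<close>.
  Distortion replaces the periodic point by \<open>i v 0 0 ...\<close>, and removing the first letter costs a factor
  depending only on \<open>i\<close>.
\<close>

lemma periodic_sum_bounds:
  assumes "0 < E" "E = exp (\<phi> (case_nat i (\<lambda>_. 0)))"
  shows "exp (- (D + K)) * E * (L ^^ m) one (\<lambda>_. 0) \<le> periodic_sum \<phi> (Suc m) i"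
    and "periodic_sum \<phi> (Suc m) i \<le> exp (D + K) * E * (L ^^ m) one (\<lambda>_. 0)"
proof -
  define z :: seq where "z = (\<lambda>_. 0)"
  define per where "per v = (\<lambda>k. (i # v) ! (k mod Suc m))" for v
  let ?P = "{\<omega>. (shift_map ^^ Suc m) \<omega> = \<omega> \<and> \<omega> 0 = i}"
  \<comment> \<open>The letter \<open>i\<close> in front is fixed, so a word of length \<open>m\<close> determines a point of period \<open>Suc m\<close>.\<close>
  have bij: "bij_betw per (words m) ?P"
  proof (rule bij_betw_byWitness[where f' = "\<lambda>\<omega>. map (\<lambda>k. \<omega> (Suc k)) [0..<m]"])
    show "\<forall>v\<in>words m. map (\<lambda>k. per v (Suc k)) [0..<m] = v"
      by (auto simp: per_def words_def intro!: nth_equalityI)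
    show "per ` words m \<subseteq> ?P"
      by (auto simp: per_def fun_eq_iff funpow_shift_map mod_add_self2 simp del: funpow.simps add_Suc_right)
    show "(\<lambda>\<omega>. map (\<lambda>k. \<omega> (Suc k)) [0..<m]) ` ?P \<subseteq> words m"
      by (auto simp: words_def)
    show "\<forall>\<omega>\<in>?P. per (map (\<lambda>k. \<omega> (Suc k)) [0..<m]) = \<omega>"
    proof safe
      fix \<omega> assume \<omega>: "(shift_map ^^ Suc m) \<omega> = \<omega>" "i = \<omega> 0"
      have per: "\<omega> (k + Suc m) = \<omega> k" for k
        using fun_cong[OF \<omega>(1), of k] by (simp only: funpow_shift_map)
      have per': "\<omega> (k + j * Suc m) = \<omega> k" for k j
      proof (induction j)
        case (Suc j)
        have "k + Suc j * Suc m = (k + j * Suc m) + Suc m" by simp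
        then show ?case by (simp only: per Suc)
      qed simp
      have "(\<omega> 0 # map (\<lambda>k. \<omega> (Suc k)) [0..<m]) ! (k mod Suc m) = \<omega> k" for k
      proof -
        have "(\<omega> 0 # map (\<lambda>k. \<omega> (Suc k)) [0..<m]) ! l = \<omega> l" if "l < Suc m" for l
          using that by (cases l) auto
        moreover have "\<omega> k = \<omega> (k mod Suc m)"
          using per'[of "k mod Suc m" "k div Suc m"] by (simp only: mod_div_mult_eq)
        ultimately show ?thesis by simp
      qed
      then show "per (map (\<lambda>k. \<omega> (Suc k)) [0..<m]) = \<omega>" by (simp add: per_def fun_eq_iff \<omega>(2))
    qed
  qed
  define q where "q v = exp (birkhoff_sum \<phi> (Suc m) (per v))" for v
  have P: "periodic_sum \<phi> (Suc m) i = infsum q (words m)"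
    unfolding periodic_sum_def q_def by (rule infsum_reindex_bij_betw[OF bij, symmetric])
  have q: "exp (- (D + K)) * E * weight v z \<le> q v" "q v \<le> exp (D + K) * E * weight v z"
    if "v \<in> words m" for v
  proof -
    have len: "length (i # v) = Suc m" using that by (simp add: words_def)
    have "per v \<in> cylinder (i # v)" using len by (auto simp: cylinder_def per_def)
    then obtain y where "per v = prepend (i # v) y" unfolding cylinder_eq by blast
    then have qy: "q v = weight (i # v) y" unfolding q_def weight_def len by simp
    have ratio: "exp (\<phi> (case_nat i (prepend v z))) \<le> exp K * E"
      using exp_le_letter_bound[of i "prepend v z"] by (simp add: letter_bound_def assms(2))
    have "exp (K * r ^ Suc 0) \<le> exp K"
      using K_nonneg r_less_1 mult_left_mono[of r 1 K] by simp
    then have "exp (K * r ^ Suc 0) * exp (\<phi> (case_nat i (prepend v z))) \<le> exp K * exp (\<phi> (case_nat i (prepend v z)))"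
      by (intro mult_right_mono) auto
    with exp_case_nat_le[OF agree_0, of i "\<lambda>_. 0" "prepend v z"]
    have "E \<le> exp K * exp (\<phi> (case_nat i (prepend v z)))" unfolding assms(2) by linarith
    then have ratio': "exp (- K) * E \<le> exp (\<phi> (case_nat i (prepend v z)))"
      by (simp add: exp_minus field_simps)
    have "q v \<le> exp D * (exp (\<phi> (case_nat i (prepend v z))) * weight v z)"
      unfolding qy weight_Cons[symmetric] by (rule weight_distortion)
    also have "\<dots> \<le> exp D * ((exp K * E) * weight v z)"
      using ratio weight_pos[of v z] by (intro mult_left_mono mult_right_mono) auto
    finally show "q v \<le> exp (D + K) * E * weight v z" by (simp add: exp_add mult_ac)
    have "exp (- K) * E * weight v z \<le> exp (\<phi> (case_nat i (prepend v z))) * weight v z"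
      using ratio' weight_pos[of v z] by (intro mult_right_mono) auto
    also have "\<dots> \<le> exp D * q v"
      unfolding qy weight_Cons[symmetric] by (rule weight_distortion)
    finally show "exp (- (D + K)) * E * weight v z \<le> q v"
      by (simp add: exp_add exp_minus exp_diff field_simps)
  qed
  have ws: "(\<lambda>w. weight w z) summable_on words m"
    using summable_weight[of one 1 z m] by simp
  have qs: "q summable_on words m"
    by (rule summable_on_real_dominated[OF summable_on_cmult_right[OF ws]])
      (use q in \<open>auto simp: q_def\<close>)
  have Lw: "(L ^^ m) one z = (\<Sum>\<^sub>\<infinity>w\<in>words m. weight w z)"
    using Lpow_words[of one 1 m z] by simp
  have "(\<Sum>\<^sub>\<infinity>w\<in>words m. exp (- (D + K)) * E * weight w z) \<le> infsum q (words m)"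
    by (intro infsum_mono summable_on_cmult_right ws qs q)
  then show "exp (- (D + K)) * E * (L ^^ m) one (\<lambda>_. 0) \<le> periodic_sum \<phi> (Suc m) i"
    unfolding P Lw[unfolded z_def] z_def infsum_cmult_right' .
  have "infsum q (words m) \<le> (\<Sum>\<^sub>\<infinity>w\<in>words m. exp (D + K) * E * weight w z)"
    by (intro infsum_mono summable_on_cmult_right ws qs q)
  then show "periodic_sum \<phi> (Suc m) i \<le> exp (D + K) * E * (L ^^ m) one (\<lambda>_. 0)"
    unfolding P Lw[unfolded z_def] z_def infsum_cmult_right' .
qed

lemma positive_recurrent: "positive_recurrent \<phi> \<rho>"
  unfolding positive_recurrent_def
proof (intro conjI allI \<rho>_pos)
  fix i
  obtain M where M: "0 < M" "\<And>n x. inverse M \<le> (L ^^ n) one x / \<rho> ^ n"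
    "\<And>n x. (L ^^ n) one x / \<rho> ^ n \<le> M"
    by (rule h_limit) (rule that)
  define E where "E = exp (\<phi> (case_nat i (\<lambda>_. 0)))"
  have E: "0 < E" by (simp add: E_def)
  define A where "A = exp (D + K) * E * M / \<rho>"
  define A' where "A' = exp (D + K) * M * \<rho> / E"
  have A: "0 < A" "0 < A'" using E M \<rho>_pos by (simp_all add: A_def A'_def)
  show "\<exists>M>0. \<exists>N. \<forall>n\<ge>N. inverse M \<le> periodic_sum \<phi> n i / \<rho> ^ n \<and> periodic_sum \<phi> n i / \<rho> ^ n \<le> M"
  proof (intro exI conjI allI impI)
    \<comment> \<open>\<open>A\<close> serves for the upper bound and \<open>A'\<close> for the lower one; both bounds survive enlarging the constant.\<close>
    show "0 < A + A'" using A by simp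
    fix n :: nat assume "1 \<le> n"
    then obtain m where n: "n = Suc m" by (cases n) auto
    define v where "v = (L ^^ m) one (\<lambda>_. 0) / \<rho> ^ m"
    have v: "inverse M \<le> v" "v \<le> M" unfolding v_def by (rule M)+
    have lo: "exp (- (D + K)) * E * v / \<rho> \<le> periodic_sum \<phi> n i / \<rho> ^ n"
      using periodic_sum_bounds(1)[OF E E_def, of m] \<rho>_pos by (simp add: n v_def field_simps)
    have hi: "periodic_sum \<phi> n i / \<rho> ^ n \<le> exp (D + K) * E * v / \<rho>"
      using periodic_sum_bounds(2)[OF E E_def, of m] \<rho>_pos by (simp add: n v_def field_simps)
    have "exp (D + K) * E * v / \<rho> \<le> A"
      unfolding A_def using v E \<rho>_pos by (intro divide_right_mono mult_left_mono) auto
    with hi A show "periodic_sum \<phi> n i / \<rho> ^ n \<le> A + A'" by linarith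
    have "inverse A' = exp (- (D + K)) * E * inverse M / \<rho>"
      unfolding A'_def exp_minus by (simp add: field_simps)
    also have "\<dots> \<le> exp (- (D + K)) * E * v / \<rho>"
      using v E \<rho>_pos by (intro divide_right_mono mult_left_mono) auto
    finally have "inverse A' \<le> periodic_sum \<phi> n i / \<rho> ^ n" using lo by linarith
    moreover have "inverse (A + A') \<le> inverse A'" using A by (intro le_imp_inverse_le) auto
    ultimately show "inverse (A + A') \<le> periodic_sum \<phi> n i / \<rho> ^ n" by linarith
  qed
qed

section \<open>Construction of the eigenmeasure\<close>

text \<open>
  Continuity from above, where tightness enters. For functions of depth \<open>m\<close> the iterate \<open>L ^^ m\<close> is
  bounded by a sum over words that does not depend on the base point, and its terms are dominated by
  the summable \<open>word_bound\<close>; hence no mass escapes through large letters.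
\<close>

lemma ell_tendsto_0:
  assumes dep: "\<And>N. depends m (f N)" and B: "\<And>N x. \<bar>f N x\<bar> \<le> B" and nonneg: "\<And>N x. 0 \<le> f N x"
    and lim: "\<And>x. (\<lambda>N. f N x) \<longlonglongrightarrow> 0"
  shows "(\<lambda>N. ell (f N)) \<longlonglongrightarrow> 0"
proof -
  define z :: seq where "z = (\<lambda>_. 0)"
  define \<delta> where "\<delta> N = (\<Sum>\<^sub>\<infinity>w\<in>words m. word_bound w * f N (prepend w z))" for N
  note hf = depends_hoelder[OF dep B]
  have dom: "(\<lambda>w. word_bound w * B) summable_on words m"
    by (intro summable_on_cmult_left summable_word_bound)
  have le: "\<bar>word_bound w * f N (prepend w z)\<bar> \<le> word_bound w * B" for N w
    using B word_bound_nonneg by (simp add: abs_mult mult_left_mono)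
  have "\<delta> \<longlonglongrightarrow> (\<Sum>\<^sub>\<infinity>w\<in>words m. 0)"
    unfolding \<delta>_def by (rule infsum_dominated_tendsto[OF dom le]) (rule tendsto_mult_right_zero[OF lim])
  then have \<delta>: "\<delta> \<longlonglongrightarrow> 0" by simp
  have "(L ^^ m) (f N) x \<le> \<delta> N" for N x
    unfolding \<delta>_def Lpow_words[OF B]
  proof (rule infsum_mono[OF summable_weight[OF B] summable_on_real_dominated[OF dom le]])
    fix w assume "w \<in> words m"
    then have "agree m (prepend w x) (prepend w z)" using agree_prepend[of w x z] by (simp add: words_def)
    then have "f N (prepend w x) = f N (prepend w z)" by (rule dependsD[OF dep])
    then show "weight w x * f N (prepend w x) \<le> word_bound w * f N (prepend w z)"
      using nonneg weight_le_word_bound by (simp add: mult_right_mono)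
  qed
  then have "ell ((L ^^ m) (f N)) \<le> ell (\<lambda>_. \<delta> N)" for N
    by (intro ell_mono hoelder_Lpow hf hoelder_const)
  then have "\<rho> ^ m * ell (f N) \<le> \<delta> N" for N
    by (simp add: ell_Lpow[OF hf] ell_const)
  then have up: "ell (f N) \<le> \<delta> N / \<rho> ^ m" for N
    using \<rho>_pos by (simp add: field_simps)
  have low: "0 \<le> ell (f N)" for N
    using ell_mono[OF hoelder_const hf nonneg] by (simp add: ell_const)
  have "(\<lambda>N. \<delta> N / \<rho> ^ m) \<longlonglongrightarrow> 0 / \<rho> ^ m"
    by (intro tendsto_divide \<delta> tendsto_const) (use \<rho>_pos in auto)
  then have lim0: "(\<lambda>N. \<delta> N / \<rho> ^ m) \<longlonglongrightarrow> 0" by simp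
  show ?thesis
  proof (rule tendsto_sandwich[OF _ _ tendsto_const lim0])
    show "\<forall>\<^sub>F N in sequentially. 0 \<le> ell (f N)" using low by simp
    show "\<forall>\<^sub>F N in sequentially. ell (f N) \<le> \<delta> N / \<rho> ^ m" using up by simp
  qed
qed

text \<open>
  The tails of a disjoint union decrease to the empty set, so continuity from above gives countable
  additivity on sets of a fixed depth.
\<close>

lemma ell_sums:
  assumes dep: "\<And>i. depends m (\<lambda>x. x \<in> E i)" and disj: "disjoint_family E"
  shows "(\<lambda>i. ell (indicat_real (E i))) sums ell (indicat_real (\<Union>i. E i))"
proof -
  define T where "T N = (\<Union>i\<in>{N..}. E i)" for N :: nat
  have depT: "depends m (\<lambda>x. x \<in> T N)" for N
    using dep unfolding T_def depends_def by blast
  have split: "indicat_real (T N) x = indicat_real (T (Suc N)) x + indicat_real (E N) x" for N x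
  proof -
    have "T N = T (Suc N) \<union> E N"
    proof -
      have "{N..} = insert N {Suc N..}" by auto
      then show ?thesis unfolding T_def by auto
    qed
    moreover have "T (Suc N) \<inter> E N = {}"
    proof -
      have "E i \<inter> E N = {}" if "i \<in> {Suc N..}" for i
        by (rule disjoint_family_onD[OF disj]) (use that in auto)
      then show ?thesis unfolding T_def by blast
    qed
    ultimately show ?thesis by (auto simp: indicator_def)
  qed
  have step: "ell (indicat_real (T N)) = ell (indicat_real (T (Suc N))) + ell (indicat_real (E N))" for N
  proof -
    have "indicat_real (T N) = (\<lambda>x. indicat_real (T (Suc N)) x + indicat_real (E N) x)"
      by (rule ext) (rule split)
    then show ?thesis using ell_add[OF hoelder_indicator[OF depT] hoelder_indicator[OF dep]] by simp
  qed
  have partial: "(\<Sum>i<N. ell (indicat_real (E i))) = ell (indicat_real (\<Union>i. E i)) - ell (indicat_real (T N))" for N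
  proof (induction N)
    case 0
    then show ?case by (simp add: T_def atLeast_0)
  next
    case (Suc N)
    then show ?case using step[of N] by simp
  qed
  have "(\<lambda>N. ell (indicat_real (T N))) \<longlonglongrightarrow> 0"
  proof (rule ell_tendsto_0[OF depends_indicator[OF depT], where B = 1])
    fix x
    have "\<forall>\<^sub>F N in sequentially. indicat_real (T N) x = 0"
    proof (cases "\<exists>i. x \<in> E i")
      case True
      then obtain i where i: "x \<in> E i" by blast
      then have "j = i" if "x \<in> E j" for j
        using disj that by (auto simp: disjoint_family_on_def)
      then have "x \<notin> T N" if "Suc i \<le> N" for N
        using that by (auto simp: T_def)
      then show ?thesis
        by (intro eventually_sequentiallyI[of "Suc i"]) (simp add: indicator_def)
    qed (auto simp: T_def indicator_def)
    then show "(\<lambda>N. indicat_real (T N) x) \<longlonglongrightarrow> 0" by (rule tendsto_eventually)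
  qed (auto simp: indicator_def)
  then have "(\<lambda>N. ell (indicat_real (\<Union>i. E i)) - ell (indicat_real (T N))) \<longlonglongrightarrow> ell (indicat_real (\<Union>i. E i)) - 0"
    by (intro tendsto_diff tendsto_const)
  then show ?thesis unfolding sums_def partial by simp
qed

text \<open>
  Letters are embedded into the real line, a Polish space, so that Kolmogorov's extension theorem applies
  to the marginals below.
\<close>

definition real_coords :: "nat set \<Rightarrow> seq \<Rightarrow> nat \<Rightarrow> real" where
  "real_coords J x = (\<lambda>j\<in>J. real (x j))"

definition marginal :: "nat set \<Rightarrow> (nat \<Rightarrow> real) measure" where
  "marginal J = measure_of (space (PiM J (\<lambda>_. borel))) (sets (PiM J (\<lambda>_. borel)))
    (\<lambda>A. ennreal (ell (indicat_real {x. real_coords J x \<in> A})))"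

lemma sets_marginal [simp]: "sets (marginal J) = sets (PiM J (\<lambda>_. borel))"
  and space_marginal [simp]: "space (marginal J) = space (PiM J (\<lambda>_. borel))"
  by (simp_all add: marginal_def)

lemma depends_real_coords:
  assumes "J \<subseteq> {..<m}"
  shows "depends m (\<lambda>x. x \<in> {x. real_coords J x \<in> A})"
proof -
  have "real_coords J x = real_coords J y" if "agree m x y" for x y
    using that assms by (auto simp: real_coords_def agree_def fun_eq_iff)
  then show ?thesis by (auto simp: depends_def)
qed

lemma emeasure_marginal:
  assumes "finite J" "A \<in> sets (PiM J (\<lambda>_. borel))"
  shows "emeasure (marginal J) A = ennreal (ell (indicat_real {x. real_coords J x \<in> A}))"
proof (rule emeasure_measure_of[OF marginal_def])
  obtain m where m: "J \<subseteq> {..<m}" using assms(1) finite_nat_iff_bounded by blast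
  show "sets (PiM J (\<lambda>_. borel)) \<subseteq> Pow (space (PiM J (\<lambda>_. borel)))" by (rule sets.space_closed)
  show "A \<in> sets (marginal J)" using assms by simp
  show "positive (sets (marginal J)) (\<lambda>A. ennreal (ell (indicat_real {x. real_coords J x \<in> A})))"
  proof -
    have "indicat_real {} = (\<lambda>_ :: seq. 0)" by auto
    then show ?thesis by (simp add: positive_def ell_const)
  qed
  show "countably_additive (sets (marginal J)) (\<lambda>A. ennreal (ell (indicat_real {x. real_coords J x \<in> A})))"
  proof (rule countably_additiveI)
    fix A :: "nat \<Rightarrow> (nat \<Rightarrow> real) set"
    assume "disjoint_family A"
    then have "disjoint_family (\<lambda>i. {x. real_coords J x \<in> A i})" by (auto simp: disjoint_family_on_def)
    from ell_sums[OF depends_real_coords[OF m] this]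
    have "(\<Sum>i. ennreal (ell (indicat_real {x. real_coords J x \<in> A i}))) = ennreal (ell (indicat_real (\<Union>i. {x. real_coords J x \<in> A i})))"
      by (rule suminf_ennreal_eq[rotated]) (rule ell_indicator_nonneg[OF depends_real_coords[OF m]])
    also have "(\<Union>i. {x. real_coords J x \<in> A i}) = {x. real_coords J x \<in> (\<Union>i. A i)}" by blast
    finally show "(\<Sum>i. ennreal (ell (indicat_real {x. real_coords J x \<in> A i}))) = ennreal (ell (indicat_real {x. real_coords J x \<in> \<Union> (range A)}))" .
  qed
qed

lemma real_coords_in_space: "real_coords J x \<in> space (PiM J (\<lambda>_. borel))"
  by (auto simp: real_coords_def space_PiM)

text \<open>
  Consistency is immediate, because all marginals evaluate the same functional on sets of sequences.
\<close>

lemma polish_projective_marginal: "polish_projective UNIV marginal"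
proof (intro polish_projective.intro projective_family.intro)
  fix J H :: "nat set" assume JH: "J \<subseteq> H" "finite H"
  then have J: "finite J" by (rule finite_subset)
  show "marginal J = distr (marginal H) (PiM J (\<lambda>_. borel)) (\<lambda>f. restrict f J)"
  proof (rule measure_eqI)
    fix A assume A: "A \<in> sets (marginal J)"
    have meas: "(\<lambda>f. restrict f J) \<in> measurable (marginal H) (PiM J (\<lambda>_. borel))"
      using measurable_restrict_subset[OF JH(1)] by (simp add: measurable_def)
    have "emeasure (distr (marginal H) (PiM J (\<lambda>_. borel)) (\<lambda>f. restrict f J)) A
        = emeasure (marginal H) ((\<lambda>f. restrict f J) -` A \<inter> space (marginal H))"
      using A by (intro emeasure_distr meas) simp
    also have "\<dots> = ennreal (ell (indicat_real {x. real_coords H x \<in> (\<lambda>f. restrict f J) -` A \<inter> space (marginal H)}))"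
      using measurable_sets[OF meas, of A] A by (intro emeasure_marginal JH) simp
    also have "{x. real_coords H x \<in> (\<lambda>f. restrict f J) -` A \<inter> space (marginal H)} = {x. real_coords J x \<in> A}"
    proof -
      have "restrict (real_coords H x) J = real_coords J x" for x
        using JH(1) by (auto simp: real_coords_def restrict_def fun_eq_iff)
      then show ?thesis using real_coords_in_space by auto
    qed
    also have "ennreal (ell (indicat_real {x. real_coords J x \<in> A})) = emeasure (marginal J) A"
      using A by (intro emeasure_marginal[symmetric] J) simp
    finally show "emeasure (marginal J) A = emeasure (distr (marginal H) (PiM J (\<lambda>_. borel)) (\<lambda>f. restrict f J)) A" ..
  qed simp
next
  fix J :: "nat set" assume "finite J"
  then have "emeasure (marginal J) (space (marginal J)) = ennreal (ell (indicat_real {x. real_coords J x \<in> space (marginal J)}))"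
    by (intro emeasure_marginal) auto
  also have "{x. real_coords J x \<in> space (marginal J)} = UNIV" using real_coords_in_space by auto
  finally show "prob_space (marginal J)" by (intro prob_spaceI) (simp add: ell_const)
qed

text \<open>
  The Kolmogorov extension is carried back to sequences of natural numbers by rounding down. Since
  finite-depth sets depend on finitely many coordinates, their measure is read off from a marginal.
\<close>

lemma exists_measure:
  "\<exists>\<nu>. sets \<nu> = sets (borel :: seq measure) \<and> prob_space \<nu> \<and>
    (\<forall>m E. depends m (\<lambda>x. x \<in> E) \<longrightarrow> emeasure \<nu> E = ennreal (ell (indicat_real E)))"
proof -
  interpret pp: polish_projective UNIV marginal by (rule polish_projective_marginal)
  define dec :: "(nat \<Rightarrow> real) \<Rightarrow> seq" where "dec f = (\<lambda>i. nat \<lfloor>f i\<rfloor>)" for f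
  have nat_floor: "(\<lambda>t :: real. nat \<lfloor>t\<rfloor>) \<in> measurable borel borel"
    by (rule measurable_compose[OF measurable_real_floor]) simp
  have dec_PiM: "(\<lambda>f i. if i \<in> J then nat \<lfloor>f i\<rfloor> else 0) \<in> measurable (PiM J (\<lambda>_. borel :: real measure)) (borel :: seq measure)"
    for J :: "nat set"
  proof -
    have "(\<lambda>f i. if i \<in> J then nat \<lfloor>f i\<rfloor> else 0) \<in> measurable (PiM J (\<lambda>_. borel :: real measure)) (PiM UNIV (\<lambda>_ :: nat. borel :: nat measure))"
    proof (rule measurable_PiM_single')
      fix i :: nat
      show "(\<lambda>f. if i \<in> J then nat \<lfloor>f i\<rfloor> else 0) \<in> measurable (PiM J (\<lambda>_. borel :: real measure)) (borel :: nat measure)"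
        by (cases "i \<in> J") (auto intro: measurable_compose[OF measurable_component_singleton[of i J "\<lambda>_. borel"] nat_floor])
    qed simp
    then show ?thesis by (simp cong: measurable_cong_sets add: sets_PiM_equal_borel)
  qed
  have dec_meas: "dec \<in> measurable pp.lim borel"
  proof -
    have "dec = (\<lambda>f i. if i \<in> UNIV then nat \<lfloor>f i\<rfloor> else 0)" by (simp add: dec_def fun_eq_iff)
    then show ?thesis using dec_PiM[of UNIV] by (simp add: measurable_def)
  qed
  define \<nu> where "\<nu> = distr pp.lim borel dec"
  have "emeasure \<nu> E = ennreal (ell (indicat_real E))" if dep: "depends m (\<lambda>x. x \<in> E)" for m E
  proof -
    define J where "J = {..<m}"
    \<comment> \<open>Coordinates outside \<open>J\<close> are set to \<open>0\<close>, and \<open>E\<close> is determined by those in \<open>J\<close>.\<close>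
    define A where "A = (\<lambda>f i. if i \<in> J then nat \<lfloor>f i\<rfloor> else 0) -` E \<inter> space (PiM J (\<lambda>_. borel :: real measure))"
    have A: "A \<in> sets (PiM J (\<lambda>_. borel))"
      unfolding A_def by (rule measurable_sets[OF dec_PiM depends_borel[OF dep]])
    have "emeasure \<nu> E = emeasure pp.lim (dec -` E \<inter> space pp.lim)"
      unfolding \<nu>_def by (rule emeasure_distr[OF dec_meas depends_borel[OF dep]])
    also have "dec -` E \<inter> space pp.lim = pp.emb UNIV J A"
    proof (intro set_eqI)
      fix f :: "nat \<Rightarrow> real"
      have "agree m (dec f) (\<lambda>i. if i \<in> J then nat \<lfloor>restrict f J i\<rfloor> else 0)"
        by (auto simp: agree_def dec_def J_def)
      then have "dec f \<in> E \<longleftrightarrow> (\<lambda>i. if i \<in> J then nat \<lfloor>restrict f J i\<rfloor> else 0) \<in> E"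
        by (rule dependsD[OF dep])
      then show "f \<in> dec -` E \<inter> space pp.lim \<longleftrightarrow> f \<in> pp.emb UNIV J A"
        by (auto simp: prod_emb_def A_def space_PiM)
    qed
    also have "emeasure pp.lim (pp.emb UNIV J A) = emeasure (marginal J) A"
      by (rule pp.emeasure_lim_emb) (use A in \<open>auto simp: J_def\<close>)
    also have "\<dots> = ennreal (ell (indicat_real {x. real_coords J x \<in> A}))"
      by (rule emeasure_marginal) (use A in \<open>auto simp: J_def\<close>)
    also have "{x. real_coords J x \<in> A} = E"
    proof (intro set_eqI)
      fix x
      have "agree m x (\<lambda>i. if i \<in> J then nat \<lfloor>real_coords J x i\<rfloor> else 0)"
        by (auto simp: agree_def real_coords_def J_def)
      then have "x \<in> E \<longleftrightarrow> (\<lambda>i. if i \<in> J then nat \<lfloor>real_coords J x i\<rfloor> else 0) \<in> E"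
        by (rule dependsD[OF dep])
      then show "x \<in> {x. real_coords J x \<in> A} \<longleftrightarrow> x \<in> E"
        using real_coords_in_space[of J x] by (auto simp: A_def)
    qed
    finally show ?thesis .
  qed
  moreover have "prob_space \<nu>" unfolding \<nu>_def by (rule pp.P.prob_space_distr[OF dec_meas])
  ultimately show ?thesis by (intro exI[of _ \<nu>]) (auto simp: \<nu>_def)
qed

end

section \<open>Integration against the eigenmeasure\<close>

locale eigenmeasure = holder_potential + prob_space \<nu> for \<nu> :: "seq measure" +
  assumes sets_nu [measurable_cong]: "sets \<nu> = sets borel"
    and emeasure_nu: "\<And>m E. depends m (\<lambda>x. x \<in> E) \<Longrightarrow> emeasure \<nu> E = ennreal (ell (indicat_real E))"

begin

lemma measurable_nu: "f \<in> borel_measurable borel \<Longrightarrow> f \<in> borel_measurable \<nu>"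
  using measurable_cong_sets[OF sets_nu refl] by blast

lemma space_nu: "space \<nu> = UNIV"
  using sets_eq_imp_space_eq[OF sets_nu] by simp

lemma integrable_nu:
  fixes f :: "seq \<Rightarrow> real"
  assumes "f \<in> borel_measurable borel" "\<And>x. \<bar>f x\<bar> \<le> B"
  shows "integrable \<nu> f"
  by (rule integrable_const_bound[where B = B]) (use assms measurable_nu in auto)

lemma integral_diff_le:
  fixes f g :: "seq \<Rightarrow> real"
  assumes "integrable \<nu> f" "integrable \<nu> g" "\<And>x. \<bar>f x - g x\<bar> \<le> e"
  shows "\<bar>(\<integral>x. f x \<partial>\<nu>) - (\<integral>x. g x \<partial>\<nu>)\<bar> \<le> e"
proof -
  have "f x \<le> g x + e" "g x \<le> f x + e" for x using assms(3)[of x] by linarith+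
  then have "(\<integral>x. f x \<partial>\<nu>) \<le> (\<integral>x. g x + e \<partial>\<nu>)" "(\<integral>x. g x \<partial>\<nu>) \<le> (\<integral>x. f x + e \<partial>\<nu>)"
    by (intro integral_mono Bochner_Integration.integrable_add assms(1,2) integrable_const; simp)+
  then show ?thesis using assms prob_space.prob_space[OF prob_space_axioms] by simp
qed

text \<open>
  Rounding \<open>f\<close> to multiples of \<open>1 / k\<close> gives a finite combination of indicators of finite-depth sets, on
  which integral and functional agree by construction; both are monotone, so the error is \<open>2 / k\<close>.
\<close>

lemma integral_eq_ell_depends:
  assumes dep: "depends m f" and B: "\<And>x. \<bar>f x\<bar> \<le> B"
  shows "(\<integral>x. f x \<partial>\<nu>) = ell f"
proof -
  have hf: "hoelder f" by (rule depends_hoelder[OF dep B])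
  have fm: "f \<in> borel_measurable borel" by (rule depends_measurable[OF dep])
  have approx: "\<bar>(\<integral>x. f x \<partial>\<nu>) - ell f\<bar> \<le> 2 / real k" if "0 < k" for k :: nat
  proof -
    define c where "c x = \<lfloor>real k * f x\<rfloor>" for x
    define g where "g x = real_of_int (c x) / real k" for x
    \<comment> \<open>All values of \<open>c\<close> lie in \<open>{- N..N}\<close>, which makes the level sets finite in number.\<close>
    define N where "N = \<lceil>real k * B\<rceil> + 1"
    define E where "E j = {x. c x = j}" for j
    have depE: "depends m (\<lambda>x. x \<in> E j)" for j
      using dependsD[OF dep] by (auto simp: depends_def E_def c_def)
    have g_le: "\<bar>f x - g x\<bar> \<le> 1 / real k" for x
    proof -
      have "\<bar>real k * f x - real_of_int (c x)\<bar> \<le> 1" unfolding c_def by linarith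
      then have "\<bar>real k * f x - real_of_int (c x)\<bar> / real k \<le> 1 / real k" by (intro divide_right_mono) auto
      moreover have "f x - g x = (real k * f x - real_of_int (c x)) / real k" using that by (simp add: g_def field_simps)
      ultimately show ?thesis by simp
    qed
    have cN: "c x \<in> {- N..N}" for x
    proof -
      have "real k * \<bar>f x\<bar> \<le> real k * B" using B by (intro mult_left_mono) auto
      then have "\<bar>real k * f x\<bar> \<le> real k * B" by (simp add: abs_mult)
      then show ?thesis unfolding c_def N_def by (auto; linarith)
    qed
    have g_sum: "g = (\<lambda>x. \<Sum>j\<in>{- N..N}. real_of_int j / real k * indicat_real (E j) x)"
    proof
      fix x
      have "(\<Sum>j\<in>{- N..N}. real_of_int j / real k * indicat_real (E j) x)
          = (\<Sum>j\<in>{c x}. real_of_int j / real k * indicat_real (E j) x)"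
        by (rule sum.mono_neutral_right) (use cN[of x] in \<open>auto simp: E_def indicator_def\<close>)
      then show "g x = (\<Sum>j\<in>{- N..N}. real_of_int j / real k * indicat_real (E j) x)"
        by (simp add: g_def E_def)
    qed
    have hE: "hoelder (\<lambda>x. real_of_int j / real k * indicat_real (E j) x)" for j
      by (intro hoelder_scale hoelder_indicator[OF depE])
    have g_hoelder: "hoelder g" and ell_g: "ell g = (\<Sum>j\<in>{- N..N}. real_of_int j / real k * ell (indicat_real (E j)))"
    proof -
      have "hoelder g \<and> ell g = (\<Sum>j\<in>{- N..N}. ell (\<lambda>x. real_of_int j / real k * indicat_real (E j) x))"
        unfolding g_sum by (rule ell_sum) (auto intro: hE simp del: times_divide_eq_left)
      then show "hoelder g" "ell g = (\<Sum>j\<in>{- N..N}. real_of_int j / real k * ell (indicat_real (E j)))"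
        unfolding ell_scale[OF hoelder_indicator[OF depE]] by blast+
    qed
    have Em: "E j \<in> sets \<nu>" for j unfolding sets_nu by (rule depends_borel[OF depE])
    have int_E: "integrable \<nu> (indicat_real (E j))" for j
      using Em by (intro integrable_real_indicator) (auto simp: less_top[symmetric])
    have int_g: "integrable \<nu> g"
      unfolding g_sum by (intro Bochner_Integration.integrable_sum integrable_mult_right int_E)
    have "measure \<nu> (E j) = ell (indicat_real (E j))" for j
      unfolding measure_def emeasure_nu[OF depE] using ell_indicator_nonneg[OF depE] by simp
    then have "(\<integral>x. g x \<partial>\<nu>) = ell g"
      unfolding ell_g unfolding g_sum using int_E Em space_nu
      by (subst Bochner_Integration.integral_sum) auto
    moreover have "\<bar>(\<integral>x. f x \<partial>\<nu>) - (\<integral>x. g x \<partial>\<nu>)\<bar> \<le> 1 / real k"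
      by (rule integral_diff_le[OF integrable_nu[OF fm B] int_g g_le])
    moreover have "\<bar>ell f - ell g\<bar> \<le> 1 / real k"
    proof -
      have "f x \<le> g x + 1 / real k" "g x \<le> f x + 1 / real k" for x using g_le[of x] by linarith+
      then have "ell f \<le> ell (\<lambda>x. g x + 1 / real k)" "ell g \<le> ell (\<lambda>x. f x + 1 / real k)"
        by (auto intro!: ell_mono hf g_hoelder hoelder_add hoelder_const)
      then show ?thesis
        using ell_add[OF g_hoelder hoelder_const] ell_add[OF hf hoelder_const] by (simp add: ell_const)
    qed
    ultimately show ?thesis by linarith
  qed
  have "(\<lambda>k. 2 / real k) \<longlonglongrightarrow> 0" by (rule lim_const_over_n)
  then have "\<bar>(\<integral>x. f x \<partial>\<nu>) - ell f\<bar> \<le> 0"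
    by (rule LIMSEQ_le_const) (use approx in \<open>auto intro!: exI[of _ 1]\<close>)
  then show ?thesis by simp
qed

text \<open>
  A finite-depth approximation \<open>g\<close> within \<open>d\<close> changes \<open>L ^^ n f / \<rho> ^ n\<close> by at most \<open>d M\<close> uniformly in \<open>n\<close>,
  where \<open>M\<close> bounds \<open>L ^^ n 1 / \<rho> ^ n\<close>. For \<open>g\<close> the convergence is already known.
\<close>

lemma convergence_uniformly_continuous:
  fixes f :: "seq \<Rightarrow> real"
  assumes B: "\<And>x. \<bar>f x\<bar> \<le> B"
    and uc: "\<And>e. 0 < e \<Longrightarrow> \<exists>m. \<forall>x y. agree m x y \<longrightarrow> \<bar>f x - f y\<bar> < e"
  shows "uniform_limit UNIV (\<lambda>n x. (L ^^ n) f x / \<rho> ^ n) (\<lambda>x. (\<integral>y. f y \<partial>\<nu>) * h x) sequentially"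
proof (rule uniform_limitI)
  fix e :: real assume "0 < e"
  obtain M where M: "0 < M" "\<And>n x. (L ^^ n) one x / \<rho> ^ n \<le> M" "\<And>x. h x \<le> M"
    by (rule h_limit) (rule that)
  \<comment> \<open>Three errors occur: \<open>d M\<close> from \<open>L ^^ n\<close>, less than \<open>d\<close> from the convergence for \<open>g\<close>, and \<open>d M\<close> from the integral.\<close>
  define d where "d = e / (2 * M + 1)"
  have d: "0 < d" using \<open>0 < e\<close> M(1) by (simp add: d_def)
  obtain m where m: "\<forall>x y. agree m x y \<longrightarrow> \<bar>f x - f y\<bar> < d" using uc[OF d] by blast
  define g where "g x = f (trunc m x)" for x
  have gB: "\<bar>g x\<bar> \<le> B" for x by (simp add: g_def B)
  have dep: "depends m g" unfolding g_def[abs_def] by (rule depends_trunc)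
  have close: "\<bar>f x - g x\<bar> \<le> d" for x using m agree_trunc[of m x] by (auto simp: g_def less_imp_le)
  have int_close: "\<bar>(\<integral>y. f y \<partial>\<nu>) - ell g\<bar> \<le> d"
    unfolding integral_eq_ell_depends[OF dep gB, symmetric]
    by (intro integral_diff_le integrable_nu[OF uniformly_continuous_measurable[OF uc] B] integrable_nu[OF depends_measurable[OF dep] gB] close)
  obtain C where C: "\<And>n x. \<bar>(L ^^ n) g x / \<rho> ^ n - ell g * h x\<bar> \<le> C * \<theta> ^ n"
    by (rule ell_rate[OF depends_hoelder[OF dep gB]]) (rule that)
  have "(\<lambda>n. C * \<theta> ^ n) \<longlonglongrightarrow> C * 0"
    using \<theta>_bounds by (intro tendsto_mult_left LIMSEQ_realpow_zero) auto
  then have "\<forall>\<^sub>F n in sequentially. C * \<theta> ^ n < d"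
    using d by (intro order_tendstoD) auto
  then show "\<forall>\<^sub>F n in sequentially. \<forall>x\<in>UNIV. dist ((L ^^ n) f x / \<rho> ^ n) ((\<integral>y. f y \<partial>\<nu>) * h x) < e"
  proof eventually_elim
    case (elim n)
    show ?case
    proof
      fix x
      have "\<bar>(L ^^ n) f x / \<rho> ^ n - (L ^^ n) g x / \<rho> ^ n\<bar> \<le> d * M"
      proof -
        have "\<bar>(L ^^ n) f x - (L ^^ n) g x\<bar> / \<rho> ^ n \<le> d * (L ^^ n) one x / \<rho> ^ n"
          using Lpow_diff_le[OF B gB close] \<rho>_pos by (intro divide_right_mono) auto
        also have "\<dots> \<le> d * M" using M(2)[of n x] d by (simp flip: times_divide_eq_right)
        finally show ?thesis using \<rho>_pos by (simp add: abs_divide flip: diff_divide_distrib)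
      qed
      moreover have "\<bar>(L ^^ n) g x / \<rho> ^ n - ell g * h x\<bar> < d" using C[of n x] elim by linarith
      moreover have "\<bar>ell g * h x - (\<integral>y. f y \<partial>\<nu>) * h x\<bar> \<le> d * M"
      proof -
        have "\<bar>ell g - (\<integral>y. f y \<partial>\<nu>)\<bar> * h x \<le> d * M"
          using int_close M(3)[of x] h_pos[of x] d by (intro mult_mono) auto
        then show ?thesis using h_pos[of x] by (simp add: abs_mult flip: left_diff_distrib)
      qed
      moreover have "d * M + d + d * M = e"
      proof -
        have "d * M + d + d * M = d * (2 * M + 1)" by (simp add: algebra_simps)
        also have "\<dots> = e" using M(1) by (simp add: d_def)
        finally show ?thesis .
      qed
      ultimately show "dist ((L ^^ n) f x / \<rho> ^ n) ((\<integral>y. f y \<partial>\<nu>) * h x) < e"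
        unfolding dist_real_def by linarith
    qed
  qed
qed

text \<open>
  Both numbers are the coefficient of \<open>h\<close> in the limit of \<open>L ^^ n f / \<rho> ^ n\<close>.
\<close>

lemma integral_eq_ell:
  assumes f: "hoelder f"
  shows "(\<integral>x. f x \<partial>\<nu>) = ell f"
proof -
  obtain B where B: "\<And>x. \<bar>f x\<bar> \<le> B" by (rule hoelder_bounded[OF f]) (rule that)
  have "(\<lambda>n. (L ^^ n) f (\<lambda>_. 0) / \<rho> ^ n) \<longlonglongrightarrow> (\<integral>x. f x \<partial>\<nu>) * h (\<lambda>_. 0)"
    by (rule tendsto_uniform_limitI[OF convergence_uniformly_continuous[OF B hoelder_uniformly_continuous[OF f]]]) auto
  then show ?thesis by (rule ell_eqI[symmetric])
qed

lemma integral_h: "(\<integral>x. h x \<partial>\<nu>) = 1"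
proof -
  have "(L ^^ n) h x = \<rho> ^ n * h x" for n x
  proof (induction n arbitrary: x)
    case (Suc n)
    then have "(L ^^ n) h = (\<lambda>x. \<rho> ^ n * h x)" by blast
    then show ?case by (simp add: L_scale L_h)
  qed simp
  then have "ell h = 1" using \<rho>_pos by (intro ell_eqI) simp
  then show ?thesis using integral_eq_ell[OF cone_hoelder[OF h_cone]] a_pos by simp
qed

text \<open>
  For Hoelder functions this is the scaling of \<open>ell\<close>. A bounded continuous \<open>g\<close> is the pointwise limit
  of its finite-depth truncations, and dominated convergence applies to the sum over letters and to
  both integrals.
\<close>

lemma integral_L:
  fixes g :: "seq \<Rightarrow> real"
  assumes cont: "continuous_on UNIV g" and B: "\<And>x. \<bar>g x\<bar> \<le> B"
  shows "(\<integral>x. L g x \<partial>\<nu>) = \<rho> * (\<integral>x. g x \<partial>\<nu>)"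
proof -
  define G where "G m x = g (trunc m x)" for m x
  have GB: "\<bar>G m x\<bar> \<le> B" for m x by (simp add: G_def B)
  have dep: "depends m (G m)" for m unfolding G_def[abs_def] by (rule depends_trunc)
  have hG: "hoelder (G m)" for m by (rule depends_hoelder[OF dep GB])
  have trunc: "(\<lambda>m. trunc m x) \<longlonglongrightarrow> x" for x
  proof -
    have "limitin (product_topology (\<lambda>_ :: nat. euclidean :: nat topology) UNIV) (\<lambda>m. trunc m x) x sequentially"
      unfolding limitin_componentwise limitin_canonical_iff
    proof (intro conjI ballI)
      fix k :: nat
      show "(\<lambda>m. trunc m x k) \<longlonglongrightarrow> x k"
        by (rule tendsto_eventually, rule eventually_sequentiallyI[of "Suc k"]) (simp add: trunc_def)
    qed (auto simp: )
    then show ?thesis unfolding euclidean_product_topology limitin_canonical_iff .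
  qed
  have lim: "(\<lambda>m. G m x) \<longlonglongrightarrow> g x" for x
    unfolding G_def by (rule continuous_on_tendsto_compose[OF cont trunc]) auto
  have limL: "(\<lambda>m. L (G m) x) \<longlonglongrightarrow> L g x" for x
    unfolding transfer_op_alt
    by (rule infsum_dominated_tendsto[OF summable_letter_bound_mult abs_exp_mult_le[OF GB]])
      (intro tendsto_mult_left lim)
  have mG: "G m \<in> borel_measurable \<nu>" "L (G m) \<in> borel_measurable \<nu>" for m
    by (intro measurable_nu hoelder_measurable hoelder_L hG)+
  have mg: "g \<in> borel_measurable \<nu>" by (rule measurable_nu[OF borel_measurable_continuous_onI[OF cont]])
  have mLg: "L g \<in> borel_measurable \<nu>" by (rule borel_measurable_LIMSEQ_real[OF limL mG(2)])
  have "(\<lambda>m. \<integral>x. G m x \<partial>\<nu>) \<longlonglongrightarrow> (\<integral>x. g x \<partial>\<nu>)"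
    by (rule integral_dominated_convergence[where w = "\<lambda>_. B"])
      (use mg mG lim GB in auto)
  then have 1: "(\<lambda>m. \<rho> * (\<integral>x. G m x \<partial>\<nu>)) \<longlonglongrightarrow> \<rho> * (\<integral>x. g x \<partial>\<nu>)" by (rule tendsto_mult_left)
  have 2: "(\<lambda>m. \<integral>x. L (G m) x \<partial>\<nu>) \<longlonglongrightarrow> (\<integral>x. L g x \<partial>\<nu>)"
    by (rule integral_dominated_convergence[where w = "\<lambda>_. S * B"])
      (use mLg mG limL L_bound[OF GB] in auto)
  have eq: "(\<integral>x. L (G m) x \<partial>\<nu>) = \<rho> * (\<integral>x. G m x \<partial>\<nu>)" for m
    unfolding integral_eq_ell[OF hG] integral_eq_ell[OF hoelder_L[OF hG]] by (rule ell_L[OF hG])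
  show ?thesis by (rule LIMSEQ_unique[OF 2]) (simp only: eq 1)
qed

lemma conj_transfer_eigen_nu: "conj_transfer_eigen \<phi> \<rho> \<nu>"
  unfolding conj_transfer_eigen_def
proof (intro allI impI)
  fix g :: "seq \<Rightarrow> real" assume g: "continuous_on UNIV g \<and> bounded (range g)"
  then obtain B where "\<And>x. \<bar>g x\<bar> \<le> B" by (auto simp: bounded_iff)
  with g show "(\<integral>\<omega>. L g \<omega> \<partial>\<nu>) = \<rho> * (\<integral>\<omega>. g \<omega> \<partial>\<nu>)" by (intro integral_L) auto
qed

end

section \<open>Variations and the coding map\<close>

lemma variation_le_iff:
  assumes "0 \<le> V"
  shows "variation n f \<le> ennreal V \<longleftrightarrow> (\<forall>x y. agree n x y \<longrightarrow> \<bar>f x - f y\<bar> \<le> V)"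
  using assms by (auto simp: variation_def SUP_le_iff agree_def)

lemma holder_continuousD:
  assumes "holder_continuous \<beta> f"
  obtains V where "0 \<le> V" "\<And>n x y. 1 \<le> n \<Longrightarrow> agree n x y \<Longrightarrow> \<bar>f x - f y\<bar> \<le> V * exp (- \<beta>) ^ n"
proof -
  obtain V where V: "0 \<le> V" "holder_const \<beta> f = ennreal V"
    using assms unfolding holder_continuous_def by (cases "holder_const \<beta> f") auto
  have "\<bar>f x - f y\<bar> \<le> V * exp (- \<beta>) ^ n" if n: "1 \<le> n" and xy: "agree n x y" for n x y
  proof -
    have "ennreal \<bar>f x - f y\<bar> \<le> variation n f"
      unfolding variation_def using xy by (intro SUP_upper2[of "(x, y)"]) (auto simp: agree_def)
    then have "ennreal (exp (\<beta> * real n)) * ennreal \<bar>f x - f y\<bar> \<le> ennreal (exp (\<beta> * real n)) * variation n f"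
      by (rule mult_left_mono) simp
    also have "\<dots> \<le> holder_const \<beta> f"
      unfolding holder_const_def using n by (intro SUP_upper) auto
    finally have "exp (\<beta> * real n) * \<bar>f x - f y\<bar> \<le> V"
      using V by (simp flip: ennreal_mult)
    then have "exp (- \<beta>) ^ n * (exp (\<beta> * real n) * \<bar>f x - f y\<bar>) \<le> exp (- \<beta>) ^ n * V"
      by (intro mult_left_mono) auto
    moreover have "exp (- \<beta>) ^ n * exp (\<beta> * real n) = 1"
      by (simp add: mult_exp_exp algebra_simps flip: exp_of_nat_mult)
    ultimately show ?thesis by (simp add: mult.commute flip: mult.assoc)
  qed
  with V show thesis by (intro that[of V])
qed

lemma holder_continuousI:
  assumes "\<And>n x y. agree n x y \<Longrightarrow> \<bar>f x - f y\<bar> \<le> V * exp (- \<beta>) ^ n"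
  shows "holder_continuous \<beta> f"
proof -
  have V: "0 \<le> V" using assms[of 0 "\<lambda>_. 0" "\<lambda>_. 0"] by simp
  have "ennreal (exp (\<beta> * real n)) * variation n f \<le> ennreal V" for n
  proof -
    have "variation n f \<le> ennreal (V * exp (- \<beta>) ^ n)"
      using assms V by (subst variation_le_iff) auto
    then have "ennreal (exp (\<beta> * real n)) * variation n f \<le> ennreal (exp (\<beta> * real n)) * ennreal (V * exp (- \<beta>) ^ n)"
      by (rule mult_left_mono) simp
    also have "\<dots> = ennreal (V * (exp (\<beta> * real n) * exp (- \<beta>) ^ n))"
      by (simp add: mult_ac flip: ennreal_mult')
    also have "exp (\<beta> * real n) * exp (- \<beta>) ^ n = 1"
      by (simp add: mult_exp_exp algebra_simps flip: exp_of_nat_mult)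
    finally show ?thesis by simp
  qed
  then have "holder_const \<beta> f \<le> ennreal V" unfolding holder_const_def by (intro SUP_least) auto
  also have "\<dots> < \<infinity>" by simp
  finally show ?thesis unfolding holder_continuous_def .
qed

lemma unif_continuousD:
  assumes "unif_continuous f" "0 < e"
  shows "\<exists>m. \<forall>x y. agree m x y \<longrightarrow> \<bar>f x - f y\<bar> < e"
proof -
  have "\<forall>\<^sub>F n in sequentially. variation n f < ennreal (e / 2)"
    using assms unfolding unif_continuous_def by (intro order_tendstoD) auto
  then obtain m where "variation m f < ennreal (e / 2)" by (auto simp: eventually_sequentially)
  then have "\<forall>x y. agree m x y \<longrightarrow> \<bar>f x - f y\<bar> \<le> e / 2"
    using variation_le_iff[of "e / 2" m f] assms(2) by (simp add: less_imp_le)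
  with assms(2) show ?thesis by (intro exI[of _ m]) force
qed

text \<open>
  The images of \<open>X\<close> are nested, compact and nonempty, and their diameters are at most
  \<open>s ^ n\<close> times that of \<open>X\<close>, so their intersection is a single point.
\<close>

lemma ifs_proj_in:
  fixes X :: "'a::metric_space set"
  assumes X: "compact X" "X \<noteq> {}" and s: "0 < s" "s < 1"
    and T: "\<And>i. T i ` X \<subseteq> X"
    and contr: "\<And>i x y. x \<in> X \<Longrightarrow> y \<in> X \<Longrightarrow> dist (T i x) (T i y) \<le> s * dist x y"
  shows "ifs_proj X T \<omega> \<in> X"
proof -
  define F where "F n = ifs_comp T \<omega> n ` X" for n
  have step: "F (Suc n) \<subseteq> F n" for n
    using T by (auto simp: F_def)
  have anti: "F n \<subseteq> F m" if "m \<le> n" for m n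
    using that by (rule lift_Suc_antimono_le[of F, OF step])
  have F0: "F 0 = X" by (simp add: F_def)
  have Tcont: "continuous_on X (T i)" for i
  proof (rule continuous_onI)
    fix x e assume "x \<in> X" "0 < (e :: real)"
    then show "\<exists>d>0. \<forall>x'\<in>X. dist x' x < d \<longrightarrow> dist (T i x') (T i x) \<le> e"
    proof (intro exI[of _ "e"] conjI ballI impI)
      fix x' assume "x' \<in> X" "dist x' x < e"
      have "dist (T i x') (T i x) \<le> s * dist x' x" by (rule contr) fact+
      also have "\<dots> \<le> 1 * dist x' x" using s by (intro mult_right_mono) auto
      finally show "dist (T i x') (T i x) \<le> e" using \<open>dist x' x < e\<close> by simp
    qed
  qed
  have cont: "continuous_on X (ifs_comp T \<omega> n)" for n
  proof (induction n)
    case (Suc n)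
    show ?case
      unfolding ifs_comp.simps
      by (rule continuous_on_compose[OF Tcont continuous_on_subset[OF Suc T]])
  qed (simp add: id_def)
  have dist: "dist (ifs_comp T \<omega> n x) (ifs_comp T \<omega> n y) \<le> s ^ n * dist x y" if "x \<in> X" "y \<in> X" for n x y
    using that
  proof (induction n arbitrary: x y)
    case (Suc n)
    have "dist (ifs_comp T \<omega> n (T (\<omega> n) x)) (ifs_comp T \<omega> n (T (\<omega> n) y)) \<le> s ^ n * dist (T (\<omega> n) x) (T (\<omega> n) y)"
      using Suc.prems T by (intro Suc.IH) blast+
    also have "\<dots> \<le> s ^ n * (s * dist x y)" using s Suc.prems by (intro mult_left_mono contr) auto
    finally show ?case by (simp add: mult_ac)
  qed simp
  have compact_F: "compact (F n)" for n
    unfolding F_def by (rule compact_continuous_image[OF cont X(1)])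
  have "X \<inter> (\<Inter>n\<in>UNIV. F n) \<noteq> {}"
  proof (rule compact_imp_fip_image[OF X(1)])
    fix I :: "nat set" assume "finite I"
    then obtain N where "\<forall>n\<in>I. n \<le> N" using finite_nat_set_iff_bounded_le by blast
    then have "F N \<subseteq> X \<inter> (\<Inter>n\<in>I. F n)" using anti F0 by blast
    moreover have "F N \<noteq> {}" using X(2) by (simp add: F_def)
    ultimately show "X \<inter> (\<Inter>n\<in>I. F n) \<noteq> {}" by blast
  qed (rule compact_imp_closed[OF compact_F])
  then obtain p where p: "\<And>n. p \<in> F n" by blast
  obtain d where d: "\<And>x y. x \<in> X \<Longrightarrow> y \<in> X \<Longrightarrow> dist x y \<le> d"
    using compact_imp_bounded[OF X(1)] unfolding bounded_two_points by blast
  have uniq: "q = p" if q: "\<And>n. 1 \<le> n \<Longrightarrow> q \<in> F n" for q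
  proof -
    have "dist q p \<le> s ^ n * d" if n: "1 \<le> n" for n
    proof -
      obtain x y where xy: "x \<in> X" "y \<in> X" "q = ifs_comp T \<omega> n x" "p = ifs_comp T \<omega> n y"
        using q[OF n] p[of n] unfolding F_def by blast
      have "s ^ n * dist x y \<le> s ^ n * d" using s d xy by (intro mult_left_mono) auto
      with dist[OF xy(1,2), of n] xy show ?thesis by simp
    qed
    moreover have "(\<lambda>n. s ^ n * d) \<longlonglongrightarrow> 0 * d"
      using s by (intro tendsto_mult_right LIMSEQ_realpow_zero) auto
    ultimately have "dist q p \<le> 0 * d"
      by (intro LIMSEQ_le_const[of "\<lambda>n. s ^ n * d"]) auto
    then show ?thesis by simp
  qed
  have "ifs_proj X T \<omega> = p"
    unfolding ifs_proj_def F_def[symmetric]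
    by (rule the_equality) (use p uniq in auto)
  with p[of 0] F0 show ?thesis by simp
qed

section \<open>Ruelle's theorem\<close>

theorem ruelle_full_shift:
  fixes \<phi> :: "seq \<Rightarrow> real"
  assumes \<beta>: "0 < \<beta>" and holder: "holder_continuous \<beta> \<phi>"
    and summable: "\<And>\<omega>. (\<lambda>i. exp (\<phi> (case_nat i \<omega>))) summable_on UNIV"
    and lam: "lam = exp (pressure \<phi>)"
  shows "positive_recurrent \<phi> lam"
    and "\<exists>M>0. \<forall>n\<ge>1. \<forall>\<omega>. inverse M \<le> (transfer_op \<phi> ^^ n) (\<lambda>_. 1) \<omega> / lam ^ n \<and>
        (transfer_op \<phi> ^^ n) (\<lambda>_. 1) \<omega> / lam ^ n \<le> M"
    and "\<exists>\<nu> h. sets \<nu> = sets borel \<and> prob_space \<nu> \<and>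
            holder_continuous \<beta> h \<and>
            (\<exists>c>0. \<exists>C. \<forall>\<omega>. c \<le> h \<omega> \<and> h \<omega> \<le> C) \<and>
            conj_transfer_eigen \<phi> lam \<nu> \<and>
            transfer_op \<phi> h = (\<lambda>\<omega>. lam * h \<omega>) \<and>
            (\<integral>\<omega>. h \<omega> \<partial>\<nu>) = 1 \<and>
            (\<forall>g. unif_continuous g \<and> bounded (range g) \<longrightarrow>
               uniform_limit UNIV (\<lambda>n \<omega>. (transfer_op \<phi> ^^ n) g \<omega> / lam ^ n)
                 (\<lambda>\<omega>. (\<integral>\<rho>. g \<rho> \<partial>\<nu>) * h \<omega>) sequentially) \<and>
            (\<forall>g. holder_continuous \<beta> g \<and> bounded (range g) \<longrightarrow>
               (\<exists>C \<theta>. 0 < \<theta> \<and> \<theta> < 1 \<and>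
                  (\<forall>n\<ge>1. \<forall>\<omega>. \<bar>(transfer_op \<phi> ^^ n) g \<omega> / lam ^ n
                                 - (\<integral>\<rho>. g \<rho> \<partial>\<nu>) * h \<omega>\<bar> \<le> C * \<theta> ^ n)))"
proof -
  obtain K where K: "0 \<le> K" "\<And>n x y. 1 \<le> n \<Longrightarrow> agree n x y \<Longrightarrow> \<bar>\<phi> x - \<phi> y\<bar> \<le> K * exp (- \<beta>) ^ n"
    by (rule holder_continuousD[OF holder]) (rule that)
  interpret P: holder_potential \<phi> "exp (- \<beta>)" K
    by unfold_locales (use \<beta> K summable in auto)
  have lam_eq: "lam = P.\<rho>" using lam P.\<rho>_pos by (simp add: P.pressure_eq)
  show "positive_recurrent \<phi> lam" unfolding lam_eq by (rule P.positive_recurrent)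
  obtain M C where M: "0 < M" "\<And>n x. inverse M \<le> (transfer_op \<phi> ^^ n) (\<lambda>_. 1) x / P.\<rho> ^ n"
    "\<And>n x. (transfer_op \<phi> ^^ n) (\<lambda>_. 1) x / P.\<rho> ^ n \<le> M"
    "\<And>x. inverse M \<le> P.h x" "\<And>x. P.h x \<le> M"
    by (rule P.h_limit) (rule that)
  show "\<exists>M>0. \<forall>n\<ge>1. \<forall>\<omega>. inverse M \<le> (transfer_op \<phi> ^^ n) (\<lambda>_. 1) \<omega> / lam ^ n \<and>
        (transfer_op \<phi> ^^ n) (\<lambda>_. 1) \<omega> / lam ^ n \<le> M"
    unfolding lam_eq using M by blast
  obtain \<nu> where \<nu>: "sets \<nu> = sets (borel :: seq measure)" "prob_space \<nu>"
    "\<And>m E. depends m (\<lambda>x. x \<in> E) \<Longrightarrow> emeasure \<nu> E = ennreal (P.ell (indicat_real E))"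
    using P.exists_measure by blast
  interpret nu: prob_space \<nu> by fact
  interpret E: eigenmeasure \<phi> "exp (- \<beta>)" K \<nu>
    by unfold_locales (use \<nu> in auto)
  have h_hoelder: "P.hoelder P.h" by (rule P.cone_hoelder[OF P.h_cone]) (use P.a_pos in simp)
  show "\<exists>\<nu> h. sets \<nu> = sets borel \<and> prob_space \<nu> \<and>
            holder_continuous \<beta> h \<and>
            (\<exists>c>0. \<exists>C. \<forall>\<omega>. c \<le> h \<omega> \<and> h \<omega> \<le> C) \<and>
            conj_transfer_eigen \<phi> lam \<nu> \<and>
            transfer_op \<phi> h = (\<lambda>\<omega>. lam * h \<omega>) \<and>
            (\<integral>\<omega>. h \<omega> \<partial>\<nu>) = 1 \<and>
            (\<forall>g. unif_continuous g \<and> bounded (range g) \<longrightarrow>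
               uniform_limit UNIV (\<lambda>n \<omega>. (transfer_op \<phi> ^^ n) g \<omega> / lam ^ n)
                 (\<lambda>\<omega>. (\<integral>\<rho>. g \<rho> \<partial>\<nu>) * h \<omega>) sequentially) \<and>
            (\<forall>g. holder_continuous \<beta> g \<and> bounded (range g) \<longrightarrow>
               (\<exists>C \<theta>. 0 < \<theta> \<and> \<theta> < 1 \<and>
                  (\<forall>n\<ge>1. \<forall>\<omega>. \<bar>(transfer_op \<phi> ^^ n) g \<omega> / lam ^ n
                                 - (\<integral>\<rho>. g \<rho> \<partial>\<nu>) * h \<omega>\<bar> \<le> C * \<theta> ^ n)))"
    unfolding lam_eq
  proof (intro exI[of _ \<nu>] exI[of _ P.h] conjI allI impI \<nu>(1,2) E.conj_transfer_eigen_nu E.integral_h)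
    show "holder_continuous \<beta> P.h"
      using h_hoelder unfolding P.hoelder_def by (auto intro: holder_continuousI)
    show "\<exists>c>0. \<exists>C. \<forall>\<omega>. c \<le> P.h \<omega> \<and> P.h \<omega> \<le> C"
      using M by (intro exI[of _ "inverse M"] conjI exI[of _ M]) auto
    show "transfer_op \<phi> P.h = (\<lambda>\<omega>. P.\<rho> * P.h \<omega>)" using P.L_h by blast
  next
    fix g :: "seq \<Rightarrow> real" assume g: "unif_continuous g \<and> bounded (range g)"
    then obtain B where B: "\<And>x. \<bar>g x\<bar> \<le> B" by (auto simp: bounded_iff)
    show "uniform_limit UNIV (\<lambda>n \<omega>. (transfer_op \<phi> ^^ n) g \<omega> / P.\<rho> ^ n)
                 (\<lambda>\<omega>. (\<integral>\<rho>. g \<rho> \<partial>\<nu>) * P.h \<omega>) sequentially"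
      using g by (intro E.convergence_uniformly_continuous[OF B] unif_continuousD) auto
  next
    fix g :: "seq \<Rightarrow> real" assume g: "holder_continuous \<beta> g \<and> bounded (range g)"
    then obtain B where B: "\<And>x. \<bar>g x\<bar> \<le> B" by (auto simp: bounded_iff)
    obtain V where V: "0 \<le> V" "\<And>n x y. 1 \<le> n \<Longrightarrow> agree n x y \<Longrightarrow> \<bar>g x - g y\<bar> \<le> V * exp (- \<beta>) ^ n"
      using g by (elim conjE holder_continuousD) (rule that)
    \<comment> \<open>The variations of \<open>g\<close> start at \<open>n = 1\<close>; for \<open>n = 0\<close> boundedness gives the estimate.\<close>
    have "\<bar>g x - g y\<bar> \<le> (V + 2 * B) * exp (- \<beta>) ^ n" if "agree n x y" for n x y
    proof (cases "n = 0")
      case True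
      then show ?thesis using B[of x] B[of y] V(1) by simp
    next
      case False
      have "0 \<le> B" using B[of x] by simp
      then have "V * exp (- \<beta>) ^ n \<le> (V + 2 * B) * exp (- \<beta>) ^ n" by (intro mult_right_mono) auto
      moreover have "\<bar>g x - g y\<bar> \<le> V * exp (- \<beta>) ^ n" using False by (intro V(2) that) auto
      ultimately show ?thesis by linarith
    qed
    then have hg: "P.hoelder g" unfolding P.hoelder_def by (intro exI[of _ "V + 2 * B"]) blast
    obtain C where C: "\<And>n x. \<bar>(transfer_op \<phi> ^^ n) g x / P.\<rho> ^ n - P.ell g * P.h x\<bar> \<le> C * P.\<theta> ^ n"
      by (rule P.ell_rate[OF hg]) (rule that)
    then show "\<exists>C \<theta>. 0 < \<theta> \<and> \<theta> < 1 \<and>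
                  (\<forall>n\<ge>1. \<forall>\<omega>. \<bar>(transfer_op \<phi> ^^ n) g \<omega> / P.\<rho> ^ n
                                 - (\<integral>\<rho>. g \<rho> \<partial>\<nu>) * P.h \<omega>\<bar> \<le> C * \<theta> ^ n)"
      using P.\<theta>_bounds by (intro exI[of _ C] exI[of _ P.\<theta>]) (simp add: E.integral_eq_ell[OF hg])
  qed
qed

theorem theorem1p2:
  fixes X :: "'a::metric_space set"
    and s \<beta> lam :: real
    and T :: "nat \<Rightarrow> 'a \<Rightarrow> 'a"
    and \<psi> :: "nat \<Rightarrow> 'a \<Rightarrow> real"
    and \<phi> :: "(nat \<Rightarrow> nat) \<Rightarrow> real"
  assumes "compact X" and "X \<noteq> {}"
    and "0 < s" and "s < 1"
    and "\<And>i. T i ` X \<subseteq> X"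
    and "\<And>i x y. x \<in> X \<Longrightarrow> y \<in> X \<Longrightarrow> dist (T i x) (T i y) \<le> s * dist x y"
    and "\<And>i. continuous_on X (\<psi> i)"
    and "(SUP x\<in>X. \<Sum>i. ennreal (exp (\<psi> i x))) < \<infinity>"
    and "\<phi> = (\<lambda>\<omega>. \<psi> (\<omega> 0) (ifs_proj X T (shift_map \<omega>)))"
    and "\<beta> > 0"
    and "holder_continuous \<beta> \<phi>"
    and "lam = exp (pressure \<phi>)"
  shows "(positive_recurrent \<phi> lam \<and>
         (\<exists>M>0. \<forall>n\<ge>1. \<forall>\<omega>.
            inverse M \<le> (transfer_op \<phi> ^^ n) (\<lambda>_. 1) \<omega> / lam ^ n \<and>
            (transfer_op \<phi> ^^ n) (\<lambda>_. 1) \<omega> / lam ^ n \<le> M)) \<and>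
         ((\<forall>i j. i \<noteq> j \<longrightarrow> T i ` X \<inter> T j ` X = {}) \<longrightarrow>
         (\<exists>\<nu> h. sets \<nu> = sets borel \<and> prob_space \<nu> \<and>
            holder_continuous \<beta> h \<and>
            (\<exists>c>0. \<exists>C. \<forall>\<omega>. c \<le> h \<omega> \<and> h \<omega> \<le> C) \<and>
            conj_transfer_eigen \<phi> lam \<nu> \<and>
            transfer_op \<phi> h = (\<lambda>\<omega>. lam * h \<omega>) \<and>
            (\<integral>\<omega>. h \<omega> \<partial>\<nu>) = 1 \<and>
            (\<forall>g. unif_continuous g \<and> bounded (range g) \<longrightarrow>
               uniform_limit UNIV (\<lambda>n \<omega>. (transfer_op \<phi> ^^ n) g \<omega> / lam ^ n)
                 (\<lambda>\<omega>. (\<integral>\<rho>. g \<rho> \<partial>\<nu>) * h \<omega>) sequentially) \<and>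
            (\<forall>g. holder_continuous \<beta> g \<and> bounded (range g) \<longrightarrow>
               (\<exists>C \<theta>. 0 < \<theta> \<and> \<theta> < 1 \<and>
                  (\<forall>n\<ge>1. \<forall>\<omega>. \<bar>(transfer_op \<phi> ^^ n) g \<omega> / lam ^ n
                                 - (\<integral>\<rho>. g \<rho> \<partial>\<nu>) * h \<omega>\<bar> \<le> C * \<theta> ^ n)))))"
proof -
  have summable: "(\<lambda>i. exp (\<phi> (case_nat i \<omega>))) summable_on UNIV" for \<omega>
  proof -
    have "ifs_proj X T \<omega> \<in> X" using assms(1-6) by (rule ifs_proj_in)
    then have "(\<Sum>i. ennreal (exp (\<psi> i (ifs_proj X T \<omega>)))) \<le> (SUP x\<in>X. \<Sum>i. ennreal (exp (\<psi> i x)))"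
      by (rule SUP_upper)
    also note assms(8)
    finally have "summable (\<lambda>i. exp (\<psi> i (ifs_proj X T \<omega>)))"
      by (intro summable_suminf_not_top) auto
    then have "(\<lambda>i. exp (\<psi> i (ifs_proj X T \<omega>))) summable_on UNIV"
      by (rule summable_nonneg_imp_summable_on) simp
    then show ?thesis by (simp add: assms(9))
  qed
  note R = ruelle_full_shift[OF assms(10,11) summable assms(12)]
  show ?thesis by (intro conjI impI R)
qed

end
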